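(* Let $R$ be an admissible ring and let $\mathcal{I}$ and $\mathcal{J}$ be regular fractional ideals of $R$. Suppose that $\alpha\in E(\mathcal{I})$ and $\mathfrak{f}(\mathcal{J})-\alpha\in E(\mathcal{J}:\mathcal{I})$. Then $\alpha$ is a maximal point of $E(\mathcal{I})$ if and only if $\mathfrak{f}(\mathcal{J})-\alpha$ is a maximal point of $E(\mathcal{J}:\mathcal{I})$. Moreover, if $\alpha$ is a maximal point of $E(\mathcal{I})$ of type $(p,q)=(p(E(\mathcal{I}),\alpha),q(E(\mathcal{I}),\alpha))$, then $\mathfrak{f}(\mathcal{J})-\alpha$ is a maximal point of $E(\mathcal{J}:\mathcal{I})$ of type $(p',q')$, where $$p'=\rho_{\mathcal{J}}\big(\mathcal{J}:(\mathcal{J}:\mathcal{I}),\,\mathfrak{f}(\mathcal{J})-\alpha\big)+1-q\big(E(\mathcal{J}:(\mathcal{J}:\mathcal{I})),\alpha\big)$$ with first term understood as $\rho_{\mathcal{J}}(\mathcal{J}:\mathcal{I},\,\mathfrak{f}(\mathcal{J})-\alpha)$, i.e. $$p'=\rho_{\mathcal{J}}\big(\mathcal{J}:\mathcal{I},\,\mathfrak{f}(\mathcal{J})-\alpha\big)+1-q\big(E(\mathcal{J}:(\mathcal{J}:\mathcal{I})),\alpha\big),$$ and $$q'=\rho_{\mathcal{J}}(\mathcal{I},\alpha)+1-p(E(\mathcal{I}),\alpha).$$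
   Context: Admissible rings: a noetherian, Cohen–Macaulay, one-dimensional local ring $(R,\mathfrak{M})$ with total ring of fractions $Q$ is admissible if it is analytically reduced (its $\mathfrak{M}$-adic completion is reduced), residually rational (each valuation ring of $Q$ over $R$ has residue field equal to $R/\mathfrak{M}$), and $\#(R/\mathfrak{M})\geq r$, where $r$ is the number of valuation rings of $Q$ over $R$. All these valuation rings are discrete (they correspond to the maximal ideals of the integral closure of $R$ in $Q$); let $v_1,\ldots,v_r$ be the associated valuations. Put $I=\{1,\ldots,r\}$, let $Q^{reg}$ be the set of regular elements of $Q$, and define $v:Q^{reg}\to\mathbb{Z}^r$ by $v(h)=(v_1(h),\ldots,v_r(h))$. $\mathbb{Z}^r$ has the componentwise partial order $\leq$. A fractional ideal is an $R$-submodule $\mathcal{I}$ of $Q$ such that $d\,\mathcal{I}\subset R$ for some regular $d\in R$; it is regular if it contains a regular element of $Q$. For regular fractional ideals, $\mathcal{J}:\mathcal{I}=\{x\in Q:\ x\mathcal{I}\subset\mathcal{J}\}$, which is again a regular fractional ideal. The value set of a regular fractional ideal $\mathcal{I}$ is $E(\mathcal{I})=v(\mathcal{I}\cap Q^{reg})\subset\mathbb{Z}^r$. Its conductor $c(\mathcal{I})$ is the unique least element $\gamma\in E(\mathcal{I})$ such that $\gamma+\mathbb{N}^r\subset E(\mathcal{I})$ (with $0\in\mathbb{N}$; such an element exists), and its Frobenius vector is $\mathfrak{f}(\mathcal{I})=c(\mathcal{I})-e$ with $e=(1,\ldots,1)$. Fibers: for $E\subset\mathbb{Z}^r$, $\alpha\in\mathbb{Z}^r$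 and $\emptyset\neq K\subset I$ ($K=I$ allowed), $F_K(E,\alpha)=\{\beta\in E:\ \beta_k=\alpha_k\ \forall k\in K,\ \beta_i>\alpha_i\ \forall i\in I\setminus K\}$, and $F(E,\alpha)=\bigcup_{i=1}^r F_{\{i\}}(E,\alpha)$. Put $$p(E,\alpha)=\max\{n:\ F_K(E,\alpha)=\emptyset\ \ \forall K\subset I,\ \#K\leq n\},\quad q(E,\alpha)=\min\{n:\ F_K(E,\alpha)\neq\emptyset\ \ \forall K\subset I,\ \#K\geq n\},$$ where $K$ is nonempty, $n$ ranges over $0,\ldots,r$ in the first formula and over $1,\ldots,r+1$ in the second (the conditions being vacuous for $n=0$, respectively $n=r+1$). A point $\alpha\in E$ is a maximal point of $E$ if $F(E,\alpha)=\emptyset$ (equivalently $p(E,\alpha)\geq1$, for $\alpha\in E$); a maximal point $\alpha$ is of type $(p,q)$ if $p=p(E,\alpha)\geq1$ and $q=q(E,\alpha)\leq r$. For regular fractional ideals $\mathcal{I},\mathcal{J}$ and $\alpha\in\mathbb{Z}^r$, $\rho_{\mathcal{J}}(\mathcal{I},\alpha)=p(E(\mathcal{I}),\alpha)+q(E(\mathcal{J}:\mathcal{I}),\mathfrak{f}(\mathcal{J})-\alpha)-1$. *)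

theory Defs
  imports
    "HOL-Algebra.Algebra"
    "HOL-Algebra.Algebraic_Closure_Type"
    "HOL-Library.Extended_Nat"
    "HOL-Library.Equipollence"
    "HOL-Analysis.Finite_Cartesian_Product"
begin

definition regular_elements :: "('a, 'm) ring_scheme \<Rightarrow> 'a set" where
  "regular_elements A =
     {x \<in> carrier A. \<forall>y \<in> carrier A. x \<otimes>\<^bsub>A\<^esub> y = \<zero>\<^bsub>A\<^esub> \<longrightarrow> y = \<zero>\<^bsub>A\<^esub>}"

definition reduced_ring :: "('a, 'm) ring_scheme \<Rightarrow> bool" where
  "reduced_ring A \<longleftrightarrow>
     (\<forall>x \<in> carrier A. \<forall>n::nat. x [^]\<^bsub>A\<^esub> n = \<zero>\<^bsub>A\<^esub> \<longrightarrow> x = \<zero>\<^bsub>A\<^esub>)"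

definition local_ring :: "('a, 'm) ring_scheme \<Rightarrow> 'a set \<Rightarrow> bool" where
  "local_ring A M \<longleftrightarrow>
     cring A \<and> maximalideal M A \<and> (\<forall>N. maximalideal N A \<longrightarrow> N = M)"

definition krull_dim :: "('a, 'm) ring_scheme \<Rightarrow> enat" where
  "krull_dim A =
     Sup {enat n |n. \<exists>P :: nat \<Rightarrow> 'a set.
            (\<forall>i \<le> n. primeideal (P i) A) \<and> (\<forall>i < n. P i \<subset> P (Suc i))}"

definition regular_sequence :: "('a, 'm) ring_scheme \<Rightarrow> 'a list \<Rightarrow> bool" where
  "regular_sequence A xs \<longleftrightarrow>
     set xs \<subseteq> carrier A \<and> genideal A (set xs) \<noteq> carrier A \<and>
     (\<forall>i < length xs.
        genideal A (set (take i xs)) +>\<^bsub>A\<^esub> (xs ! i)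
          \<in> regular_elements (A Quot genideal A (set (take i xs))))"

definition depth :: "('a, 'm) ring_scheme \<Rightarrow> 'a set \<Rightarrow> enat" where
  "depth A M = Sup {enat (length xs) |xs. regular_sequence A xs \<and> set xs \<subseteq> M}"

definition cohen_macaulay_local :: "('a, 'm) ring_scheme \<Rightarrow> 'a set \<Rightarrow> bool" where
  "cohen_macaulay_local A M \<longleftrightarrow>
     noetherian_ring A \<and> local_ring A M \<and> depth A M = krull_dim A"

definition ideal_power :: "('a, 'm) ring_scheme \<Rightarrow> 'a set \<Rightarrow> nat \<Rightarrow> 'a set" where
  "ideal_power A M n = M [^]\<^bsub>ideals_set A\<^esub> n"

text \<open>The inverse limit of the rings \<open>A / M\<^sup>n\<close>.  The transition map sends a coset of
  \<open>M\<^sup>n\<^sup>+\<^sup>1\<close> to the coset of \<open>M\<^sup>n\<close> containing it, so compatibility of a family of cosets is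
  the inclusion \<open>s (Suc n) \<subseteq> s n\<close>.\<close>

definition adic_completion :: "('a, 'm) ring_scheme \<Rightarrow> 'a set \<Rightarrow> (nat \<Rightarrow> 'a set) ring" where
  "adic_completion A M =
     \<lparr>carrier = {s. \<forall>n. s n \<in> carrier (A Quot ideal_power A M n) \<and> s (Suc n) \<subseteq> s n},
      monoid.mult = (\<lambda>s t n. s n \<otimes>\<^bsub>A Quot ideal_power A M n\<^esub> t n),
      one = (\<lambda>n. \<one>\<^bsub>A Quot ideal_power A M n\<^esub>),
      ring.zero = (\<lambda>n. \<zero>\<^bsub>A Quot ideal_power A M n\<^esub>),
      add = (\<lambda>s t n. s n \<oplus>\<^bsub>A Quot ideal_power A M n\<^esub> t n)\<rparr>"

definition analytically_reduced :: "('a, 'm) ring_scheme \<Rightarrow> 'a set \<Rightarrow> bool" where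
  "analytically_reduced A M \<longleftrightarrow> reduced_ring (adic_completion A M)"

text \<open>The total ring of fractions \<open>Q\<close> is the ring formed by the type \<open>'a::comm_ring_1\<close>;
  the ring \<open>R\<close>, its valuation rings and its fractional ideals are subsets of that type.\<close>

abbreviation ring_on :: "'a::comm_ring_1 set \<Rightarrow> 'a ring" where
  "ring_on S \<equiv> ring_of_type_algebra\<lparr>carrier := S\<rparr>"

definition Q_reg :: "'a::comm_ring_1 set" where
  "Q_reg = regular_elements (ring_of_type_algebra :: 'a ring)"

definition has_total_ring_of_fractions :: "'a::comm_ring_1 set \<Rightarrow> bool" where
  "has_total_ring_of_fractions R \<longleftrightarrow>
     subcring R (ring_of_type_algebra :: 'a ring) \<and>
     (\<forall>s \<in> regular_elements (ring_on R). s dvd 1) \<and>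
     (\<forall>x. \<exists>a \<in> R. \<exists>s \<in> regular_elements (ring_on R). s * x = a)"

text \<open>For \<open>Q\<close> a field these are the usual valuation rings other than \<open>Q\<close> itself; for \<open>Q\<close> a
  finite product of fields they are the preimages, under a projection to a factor, of the
  proper valuation rings of that factor.\<close>

definition valuation_rings :: "'a::comm_ring_1 set \<Rightarrow> 'a set set" where
  "valuation_rings R =
     {V. subring V (ring_of_type_algebra :: 'a ring) \<and> V \<noteq> UNIV \<and>
         (\<forall>x y. x \<notin> V \<longrightarrow> y \<notin> V \<longrightarrow> x * y \<notin> V) \<and> R \<subseteq> V}"

text \<open>When \<open>Q\<close> is not a field, a valuation ring \<open>V\<close> of \<open>Q\<close> need not be local (for instance
  \<open>W \<times> L\<close> in \<open>K \<times> L\<close>).  Its residue field is taken at its regular maximal ideal, that is,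
  the maximal ideal containing a regular element; it agrees with \<open>R / M\<close> if
  \<open>R / M \<rightarrow> V / N\<close> is bijective.\<close>

definition residually_rational :: "'a::comm_ring_1 set \<Rightarrow> 'a set \<Rightarrow> bool" where
  "residually_rational R M \<longleftrightarrow>
     (\<forall>V \<in> valuation_rings R. \<forall>N.
        maximalideal N (ring_on V) \<and> N \<inter> Q_reg \<noteq> {} \<longrightarrow>
        N \<inter> R = M \<and> (\<lambda>x. N +>\<^bsub>ring_on V\<^esub> x) ` R = carrier (ring_on V Quot N))"

definition admissible_ring :: "'a::comm_ring_1 set \<Rightarrow> 'a set \<Rightarrow> bool" where
  "admissible_ring R M \<longleftrightarrow>
     has_total_ring_of_fractions R \<and>
     cohen_macaulay_local (ring_on R) M \<and>
     krull_dim (ring_on R) = 1 \<and>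
     analytically_reduced (ring_on R) M \<and>
     residually_rational R M \<and>
     valuation_rings R \<lesssim> carrier (ring_on R Quot M)"

text \<open>The normalized discrete valuation of a valuation ring \<open>V\<close>, on regular elements:
  the identification of the ordered group of regular elements of \<open>Q\<close> modulo units of \<open>V\<close>
  with the integers.  It is determined by \<open>V\<close> on regular elements; its values elsewhere
  are irrelevant.\<close>

definition discrete_valuation_of :: "'a::comm_ring_1 set \<Rightarrow> ('a \<Rightarrow> int) \<Rightarrow> bool" where
  "discrete_valuation_of V w \<longleftrightarrow>
     w ` Q_reg = UNIV \<and>
     (\<forall>x \<in> Q_reg. \<forall>y \<in> Q_reg. w (x * y) = w x + w y) \<and>
     (\<forall>x \<in> Q_reg. \<forall>y \<in> Q_reg. x + y \<in> Q_reg \<longrightarrow> min (w x) (w y) \<le> w (x + y)) \<and>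
     (\<forall>x \<in> Q_reg. x \<in> V \<longleftrightarrow> 0 \<le> w x)"

definition fractional_ideal :: "'a::comm_ring_1 set \<Rightarrow> 'a set \<Rightarrow> bool" where
  "fractional_ideal R I \<longleftrightarrow>
     0 \<in> I \<and> (\<forall>x \<in> I. \<forall>y \<in> I. x + y \<in> I) \<and> (\<forall>a \<in> R. \<forall>x \<in> I. a * x \<in> I) \<and>
     (\<exists>d \<in> regular_elements (ring_on R). \<forall>x \<in> I. d * x \<in> R)"

definition regular_fractional_ideal :: "'a::comm_ring_1 set \<Rightarrow> 'a set \<Rightarrow> bool" where
  "regular_fractional_ideal R I \<longleftrightarrow> fractional_ideal R I \<and> I \<inter> Q_reg \<noteq> {}"

definition colon :: "'a::comm_ring_1 set \<Rightarrow> 'a set \<Rightarrow> 'a set" where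
  "colon J I = {x. \<forall>y \<in> I. x * y \<in> J}"

definition value_set :: "('r::finite \<Rightarrow> 'a::comm_ring_1 \<Rightarrow> int) \<Rightarrow> 'a set \<Rightarrow> (int ^ 'r) set" where
  "value_set v I = (\<lambda>h. \<chi> i. v i h) ` (I \<inter> Q_reg)"

definition conductor :: "(int ^ 'r::finite) set \<Rightarrow> int ^ 'r" where
  "conductor E = (LEAST \<gamma>. \<gamma> \<in> E \<and> (\<forall>\<beta> \<ge> 0. \<gamma> + \<beta> \<in> E))"

text \<open>In \<open>int ^ 'r\<close> the constant \<open>1\<close> is the all-ones vector.\<close>

definition frobenius_vector :: "('r::finite \<Rightarrow> 'a::comm_ring_1 \<Rightarrow> int) \<Rightarrow> 'a set \<Rightarrow> int ^ 'r" where
  "frobenius_vector v J = conductor (value_set v J) - 1"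

definition fiber :: "'r set \<Rightarrow> (int ^ 'r::finite) set \<Rightarrow> int ^ 'r \<Rightarrow> (int ^ 'r) set" where
  "fiber K E \<alpha> = {\<beta> \<in> E. (\<forall>k \<in> K. \<beta> $ k = \<alpha> $ k) \<and> (\<forall>i. i \<notin> K \<longrightarrow> \<beta> $ i > \<alpha> $ i)}"

definition fiber_union :: "(int ^ 'r::finite) set \<Rightarrow> int ^ 'r \<Rightarrow> (int ^ 'r) set" where
  "fiber_union E \<alpha> = (\<Union>i. fiber {i} E \<alpha>)"

definition p_number :: "(int ^ 'r::finite) set \<Rightarrow> int ^ 'r \<Rightarrow> nat" where
  "p_number E \<alpha> =
     Max {n \<in> {0..CARD('r)}. \<forall>K. K \<noteq> {} \<and> card K \<le> n \<longrightarrow> fiber K E \<alpha> = {}}"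

definition q_number :: "(int ^ 'r::finite) set \<Rightarrow> int ^ 'r \<Rightarrow> nat" where
  "q_number E \<alpha> =
     Min {n \<in> {1..CARD('r) + 1}. \<forall>K. K \<noteq> {} \<and> card K \<ge> n \<longrightarrow> fiber K E \<alpha> \<noteq> {}}"

definition maximal_point :: "(int ^ 'r::finite) set \<Rightarrow> int ^ 'r \<Rightarrow> bool" where
  "maximal_point E \<alpha> \<longleftrightarrow> \<alpha> \<in> E \<and> fiber_union E \<alpha> = {}"

definition maximal_point_of_type ::
    "(int ^ 'r::finite) set \<Rightarrow> int ^ 'r \<Rightarrow> nat \<Rightarrow> nat \<Rightarrow> bool" where
  "maximal_point_of_type E \<alpha> p q \<longleftrightarrow>
     maximal_point E \<alpha> \<and>
     p = p_number E \<alpha> \<and> 1 \<le> p \<and> q = q_number E \<alpha> \<and> q \<le> CARD('r)"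

definition rho ::
    "('r::finite \<Rightarrow> 'a::comm_ring_1 \<Rightarrow> int) \<Rightarrow> 'a set \<Rightarrow> 'a set \<Rightarrow> int ^ 'r \<Rightarrow> int" where
  "rho v J I \<alpha> =
     int (p_number (value_set v I) \<alpha>)
     + int (q_number (value_set v (colon J I)) (frobenius_vector v J - \<alpha>)) - 1"

end

theory Submission
  imports Defs
begin

text \<open>
  Write \<open>f\<close> for the Frobenius vector of \<open>J\<close>. The theorem rests on the fact that no regular
  element of \<open>J\<close> has a value in one of the fibers \<open>F\<^sub>i\<close> at \<open>f\<close>
  (\<open>no_fiber_at_frobenius\<close>). If \<open>x \<in> I\<close> has value \<open>\<alpha>\<close> and \<open>y \<in> J : I\<close> has its value in
  \<open>F\<^sub>i\<close> at \<open>f - \<alpha>\<close>, then \<open>x y \<in> J\<close> has its value in \<open>F\<^sub>i\<close> at \<open>f\<close>, which is impossible; the same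
  holds with the roles of \<open>I\<close> and \<open>J : I\<close> exchanged (\<open>no_fiber_at_complement\<close>). Hence
  \<open>\<alpha> \<in> E(I)\<close> makes the fibers of \<open>E(J : I)\<close> at \<open>f - \<alpha>\<close> empty, \<open>f - \<alpha> \<in> E(J : I)\<close> makes those of
  \<open>E(I)\<close> at \<open>\<alpha>\<close> empty, and both points are maximal. The formulas for \<open>p'\<close> and \<open>q'\<close> are the
  definition of \<open>\<rho>\<close> solved for one of its summands; \<open>p' \<ge> 1\<close> restates maximality, and \<open>q' \<le> r\<close>
  restates that the point belongs to the value set.

  That the fibers at \<open>f\<close> are empty is a combinatorial property of subsets of \<open>\<int>\<^sup>r\<close> that are
  closed under componentwise minima, have the exchange property, are bounded below and
  contain a translate of \<open>\<nat>\<^sup>r\<close> (\<open>no_fiber_below_conductor\<close>). Minima come from the size of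
  the residue field (\<open>value_set_min\<close>) and exchange from residual rationality
  (\<open>value_set_exchange\<close>). Both use linear combinations of regular elements, which may fail
  to be regular; \<open>finite_nonregular\<close> repairs this by a small change of a coefficient.

  A translate of \<open>\<nat>\<^sup>r\<close> inside a value set is found by combinatorics as well
  (\<open>contains_orthant\<close>). The value semigroup of \<open>R\<close> contains every large integer in each
  coordinate. Since no two of the valuations are proportional, exchange produces, for every
  \<open>i\<close>, elements whose coordinate \<open>i\<close> stays fixed while all others grow beyond any bound; sums
  and minima of such elements fill an orthant.
\<close>

no_notation fps_nth (infixl "$" 75)


section \<open>Good subsets of \<open>\<int>\<^sup>r\<close> and their conductors\<close>

text \<open>These are two of the axioms of a good semigroup ideal in the sense of Barucci, D'Anna and
Froeberg; the existence of a conductor is kept apart, since it has to be derived.\<close>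
locale good_set =
  fixes E :: "(int ^ 'r::finite) set"
  assumes min_closed: "\<lbrakk>a \<in> E; b \<in> E\<rbrakk> \<Longrightarrow> (\<chi> k. min (a $ k) (b $ k)) \<in> E"
    and exchange: "\<lbrakk>a \<in> E; b \<in> E; a $ j = b $ j\<rbrakk> \<Longrightarrow>
      \<exists>g \<in> E. a $ j < g $ j \<and> (\<forall>k. min (a $ k) (b $ k) \<le> g $ k) \<and>
        (\<forall>k. a $ k \<noteq> b $ k \<longrightarrow> g $ k = min (a $ k) (b $ k))"
begin

lemma Min_closed:
  assumes "finite A" "A \<noteq> {}" "\<And>i. i \<in> A \<Longrightarrow> f i \<in> E"
  shows "(\<chi> k. Min ((\<lambda>i. f i $ k) ` A)) \<in> E"
  using assms
proof (induction A rule: finite_ne_induct)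
  case (singleton x)
  then show ?case by simp
next
  case (insert x A)
  have "(\<chi> k. min (f x $ k) ((\<chi> k. Min ((\<lambda>i. f i $ k) ` A)) $ k)) \<in> E"
    using insert by (intro min_closed) auto
  then show ?case using insert.hyps by simp
qed

text \<open>The set of \<open>\<gamma>\<close> with \<open>\<gamma> + \<nat>\<^sup>r \<subseteq> E\<close> inherits closure under minima from \<open>E\<close>, and it is bounded
below because it is contained in \<open>E\<close>. So the vector of the minima of its coordinates
belongs to it.\<close>
lemma least_orthant:
  assumes below: "\<forall>\<beta>\<in>E. b \<le> \<beta>"
    and orth: "\<forall>\<beta>\<ge>\<gamma>0. \<beta> \<in> E"
  shows "\<exists>\<delta>. (\<forall>\<beta>\<ge>\<delta>. \<beta> \<in> E) \<and> (\<forall>\<gamma>. (\<forall>\<beta>\<ge>\<gamma>. \<beta> \<in> E) \<longrightarrow> \<delta> \<le> \<gamma>)"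
proof -
  define G where "G = {\<gamma>. \<forall>\<beta>\<ge>\<gamma>. \<beta> \<in> E}"
  have "\<exists>g. g \<in> G \<and> (\<forall>\<gamma>\<in>G. g $ i \<le> \<gamma> $ i)" for i
  proof -
    have "\<gamma>0 \<in> G" using orth by (simp add: G_def)
    from ex_has_least_nat[of "\<lambda>\<gamma>. \<gamma> \<in> G" \<gamma>0 "\<lambda>\<gamma>. nat (\<gamma> $ i - b $ i)", OF this]
    obtain g where g: "g \<in> G" "\<And>\<gamma>. \<gamma> \<in> G \<Longrightarrow> nat (g $ i - b $ i) \<le> nat (\<gamma> $ i - b $ i)"
      by blast
    have "b $ i \<le> \<gamma> $ i" if "\<gamma> \<in> G" for \<gamma>
    proof -
      have "\<gamma> \<in> E" using that by (simp add: G_def)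
      then show ?thesis using below by (simp add: less_eq_vec_def)
    qed
    then have "g $ i \<le> \<gamma> $ i" if "\<gamma> \<in> G" for \<gamma>
      using g(2)[OF that] that by (simp add: nat_le_eq_zle)
    then show ?thesis using g(1) by blast
  qed
  then obtain g where g: "\<And>i. g i \<in> G" "\<And>i \<gamma>. \<gamma> \<in> G \<Longrightarrow> g i $ i \<le> \<gamma> $ i"
    by metis
  define \<delta> where "\<delta> = (\<chi> i. g i $ i)"
  have "\<beta> \<in> E" if "\<delta> \<le> \<beta>" for \<beta>
  proof -
    \<comment> \<open>\<open>\<beta>\<close> is the minimum over \<open>i\<close> of the vectors \<open>max \<beta> (g i)\<close>: none of them is below \<open>\<beta>\<close>,
      and the \<open>k\<close>-th one agrees with \<open>\<beta>\<close> at coordinate \<open>k\<close>.\<close>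
    define f where "f = (\<lambda>i. (\<chi> k. max (\<beta> $ k) (g i $ k)))"
    have "f i \<in> E" for i
      using g(1)[of i] by (auto simp: G_def f_def less_eq_vec_def)
    then have "(\<chi> k. Min ((\<lambda>i. f i $ k) ` UNIV)) \<in> E"
      by (intro Min_closed) auto
    moreover have "Min ((\<lambda>i. f i $ k) ` UNIV) = \<beta> $ k" for k
    proof (rule Min_eqI)
      have "f k $ k = \<beta> $ k"
        using that by (auto simp: f_def \<delta>_def less_eq_vec_def max_def intro: order.antisym)
      then show "\<beta> $ k \<in> range (\<lambda>i. f i $ k)" by (metis rangeI)
    qed (auto simp: f_def)
    then have "(\<chi> k. Min ((\<lambda>i. f i $ k) ` UNIV)) = \<beta>"
      by (simp add: vec_eq_iff)
    ultimately show ?thesis by metis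
  qed
  moreover have "\<delta> \<le> \<gamma>" if "\<gamma> \<in> G" for \<gamma>
    using g(2)[OF that] by (simp add: \<delta>_def less_eq_vec_def)
  ultimately show ?thesis unfolding G_def by blast
qed

text \<open>The conductor is the least element of an explicit set, which is a definite object only
once that least element is known to exist; the boundedness assumptions provide it.\<close>
lemma conductor_orthant:
  assumes "\<forall>\<beta>\<in>E. b \<le> \<beta>" and "\<forall>\<beta>\<ge>\<gamma>0. \<beta> \<in> E"
  shows "conductor E \<le> \<beta> \<Longrightarrow> \<beta> \<in> E"
    and "(\<And>\<beta>. \<gamma> \<le> \<beta> \<Longrightarrow> \<beta> \<in> E) \<Longrightarrow> conductor E \<le> \<gamma>"
proof -
  obtain \<delta> where \<delta>: "\<And>\<beta>. \<delta> \<le> \<beta> \<Longrightarrow> \<beta> \<in> E"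
      "\<And>\<gamma>. (\<forall>\<beta>\<ge>\<gamma>. \<beta> \<in> E) \<Longrightarrow> \<delta> \<le> \<gamma>"
    using least_orthant[OF assms] by blast
  have orthant_iff: "(\<gamma> \<in> E \<and> (\<forall>\<beta>\<ge>0. \<gamma> + \<beta> \<in> E)) \<longleftrightarrow> (\<forall>\<beta>\<ge>\<gamma>. \<beta> \<in> E)" for \<gamma>
  proof safe
    fix \<beta> assume "\<forall>\<beta>\<ge>0. \<gamma> + \<beta> \<in> E" "\<gamma> \<le> \<beta>"
    moreover from this have "0 \<le> \<beta> - \<gamma>" by (simp add: less_eq_vec_def)
    ultimately have "\<gamma> + (\<beta> - \<gamma>) \<in> E" by blast
    then show "\<beta> \<in> E" by simp
  qed (auto simp: less_eq_vec_def)
  have "conductor E = \<delta>"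
    unfolding conductor_def orthant_iff using \<delta> by (intro Least_equality) auto
  then show "conductor E \<le> \<beta> \<Longrightarrow> \<beta> \<in> E"
    and "(\<And>\<beta>. \<gamma> \<le> \<beta> \<Longrightarrow> \<beta> \<in> E) \<Longrightarrow> conductor E \<le> \<gamma>"
    using \<delta> by auto
qed

text \<open>Exchanging \<open>h\<close> with \<open>max h c\<close>, which agrees with \<open>h\<close> at every coordinate except \<open>i\<close>, raises any
chosen coordinate \<open>j \<noteq> i\<close> and keeps the coordinate \<open>i\<close>, where \<open>h\<close> is strictly smaller. The
total deficit to \<open>\<beta>\<close> away from \<open>i\<close> drops with each exchange.\<close>
lemma raise_off_coordinate:
  assumes c: "\<And>\<beta>. c \<le> \<beta> \<Longrightarrow> \<beta> \<in> E"
    and h: "h \<in> E" "h $ i < c $ i" "\<And>j. j \<noteq> i \<Longrightarrow> c $ j \<le> h $ j"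
  shows "\<exists>h' \<in> E. h' $ i = h $ i \<and> (\<forall>j. j \<noteq> i \<longrightarrow> \<beta> $ j \<le> h' $ j)"
  using h
proof (induction "\<Sum>j\<in>UNIV - {i}. nat (\<beta> $ j - h $ j)" arbitrary: h rule: less_induct)
  case less
  show ?case
  proof (cases "\<forall>j. j \<noteq> i \<longrightarrow> \<beta> $ j \<le> h $ j")
    case True
    then show ?thesis using less.prems by auto
  next
    case False
    then obtain j where j: "j \<noteq> i" "h $ j < \<beta> $ j" by auto
    define d where "d = (\<chi> k. max (h $ k) (c $ k))"
    have "d \<in> E" by (rule c) (simp add: d_def less_eq_vec_def)
    moreover have "h $ j = d $ j" using less.prems(3)[OF j(1)] by (simp add: d_def)
    ultimately obtain g where g: "g \<in> E" "h $ j < g $ j"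
        "\<And>k. min (h $ k) (d $ k) \<le> g $ k"
        "\<And>k. h $ k \<noteq> d $ k \<Longrightarrow> g $ k = min (h $ k) (d $ k)"
      using exchange[OF less.prems(1)] by metis
    have g_i: "g $ i = h $ i" using g(4)[of i] less.prems(2) by (simp add: d_def)
    have g_ge: "h $ k \<le> g $ k" for k using g(3)[of k] by (simp add: d_def)
    have "\<exists>h' \<in> E. h' $ i = g $ i \<and> (\<forall>j. j \<noteq> i \<longrightarrow> \<beta> $ j \<le> h' $ j)"
    proof (rule less.hyps)
      show "(\<Sum>j\<in>UNIV - {i}. nat (\<beta> $ j - g $ j)) < (\<Sum>j\<in>UNIV - {i}. nat (\<beta> $ j - h $ j))"
      proof (rule sum_strict_mono_ex1)
        show "\<forall>k\<in>UNIV - {i}. nat (\<beta> $ k - g $ k) \<le> nat (\<beta> $ k - h $ k)"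
          using g_ge by (auto intro: nat_mono)
        show "\<exists>k\<in>UNIV - {i}. nat (\<beta> $ k - g $ k) < nat (\<beta> $ k - h $ k)"
          using j g(2) by (intro bexI[of _ j]) auto
      qed simp
      show "g \<in> E" "g $ i < c $ i" using g(1) g_i less.prems by auto
      show "c $ k \<le> g $ k" if "k \<noteq> i" for k
        using less.prems(3)[OF that] g_ge[of k] by linarith
    qed
    then show ?thesis using g_i by simp
  qed
qed

text \<open>If some \<open>h\<close> lay in the fiber at coordinate \<open>i\<close>, the orthant at \<open>c - e\<^sub>i\<close> would already be
contained in \<open>E\<close>, where \<open>c\<close> is the conductor and \<open>e\<^sub>i\<close> the unit vector: a point \<open>\<beta>\<close> of that
orthant with \<open>\<beta>\<^sub>i = c\<^sub>i - 1\<close> is the minimum of \<open>max \<beta> c\<close> and of an element obtained from \<open>h\<close>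
by raising its coordinates other than \<open>i\<close>. This contradicts the choice of \<open>c\<close>.\<close>
lemma no_fiber_below_conductor:
  assumes bounds: "\<forall>\<beta>\<in>E. b \<le> \<beta>" "\<forall>\<beta>\<ge>\<gamma>0. \<beta> \<in> E"
  shows "fiber_union E (conductor E - 1) = {}"
proof (rule ccontr)
  define c where "c = conductor E"
  note c_orthant = conductor_orthant(1)[OF bounds, folded c_def]
  note c_least = conductor_orthant(2)[OF bounds, folded c_def]
  assume "fiber_union E (conductor E - 1) \<noteq> {}"
  then obtain i h where "h \<in> fiber {i} E (c - 1)"
    by (auto simp: fiber_union_def c_def)
  then have h: "h \<in> E" "h $ i = c $ i - 1" "\<And>j. j \<noteq> i \<Longrightarrow> c $ j \<le> h $ j"
    by (auto simp: fiber_def)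
  define c' where "c' = (\<chi> k. if k = i then c $ i - 1 else c $ k)"
  have "\<beta> \<in> E" if \<beta>: "c' \<le> \<beta>" for \<beta>
  proof (cases "c $ i \<le> \<beta> $ i")
    case True
    have "c $ k \<le> \<beta> $ k" for k
      using \<beta>[unfolded less_eq_vec_def, rule_format, of k] True by (cases "k = i") (auto simp: c'_def)
    then show ?thesis using c_orthant by (auto simp: less_eq_vec_def)
  next
    case False
    have \<beta>_i: "\<beta> $ i = c $ i - 1"
      using \<beta>[unfolded less_eq_vec_def, rule_format, of i] False by (simp add: c'_def)
    have \<beta>_ge: "c $ k \<le> \<beta> $ k" if "k \<noteq> i" for k
      using \<beta>[unfolded less_eq_vec_def, rule_format, of k] that by (simp add: c'_def)
    obtain h' where h': "h' \<in> E" "h' $ i = h $ i" "\<And>j. j \<noteq> i \<Longrightarrow> \<beta> $ j \<le> h' $ j"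
      using raise_off_coordinate[of c h i \<beta>] c_orthant h by auto
    define d where "d = (\<chi> k. max (\<beta> $ k) (c $ k))"
    have "c \<le> d" by (simp add: d_def less_eq_vec_def)
    then have "d \<in> E" by (rule c_orthant)
    then have "(\<chi> k. min (h' $ k) (d $ k)) \<in> E" using h' by (intro min_closed)
    moreover have "min (h' $ k) (d $ k) = \<beta> $ k" for k
      using h'(2) h'(3)[of k] h(2) \<beta>_i \<beta>_ge[of k] by (cases "k = i") (auto simp: d_def)
    ultimately show ?thesis by simp
  qed
  then have "c \<le> c'" by (rule c_least)
  then have "c $ i \<le> c' $ i" by (simp add: less_eq_vec_def)
  then show False by (simp add: c'_def)
qed

end

section \<open>Good semigroups contain an orthant\<close>

text \<open>\<open>consecutive\<close> says that the differences of \<open>j\<close>-th coordinates generate \<open>\<int>\<close>, and \<open>independent\<close>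
that no two coordinates are proportional on \<open>S\<close>.\<close>
locale good_semigroup = good_set S for S :: "(int ^ 'r::finite) set" +
  assumes add_closed: "\<lbrakk>a \<in> S; b \<in> S\<rbrakk> \<Longrightarrow> a + b \<in> S"
    and zero_mem: "0 \<in> S"
    and nonneg: "a \<in> S \<Longrightarrow> 0 \<le> a $ k"
    and positive: "\<exists>m \<in> S. \<forall>k. 0 < m $ k"
    and consecutive: "\<exists>s \<in> S. \<exists>t \<in> S. s $ j = t $ j + 1"
    and independent: "i \<noteq> j \<Longrightarrow> \<exists>s \<in> S. \<exists>t \<in> S. s $ i * t $ j \<noteq> s $ j * t $ i"
begin

lemma multiple_closed: "a \<in> S \<Longrightarrow> (\<chi> k. int n * a $ k) \<in> S"
proof (induction n)
  case 0
  have "(\<chi> k. int 0 * a $ k) = 0" by (simp add: vec_eq_iff)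
  then show ?case using zero_mem by simp
next
  case (Suc n)
  have "(\<chi> k. int (Suc n) * a $ k) = a + (\<chi> k. int n * a $ k)"
    by (simp add: vec_eq_iff algebra_simps)
  then show ?case using add_closed[OF Suc.prems Suc.IH[OF Suc.prems]] by simp
qed

text \<open>Combinations of two elements with consecutive \<open>j\<close>-th coordinates represent every residue
modulo \<open>m\<^sub>j\<close>. Adding multiples of \<open>m\<close> then reaches every large \<open>n\<close> at coordinate \<open>j\<close>, while
the other coordinates grow at least along the direction of \<open>m\<close>.\<close>
lemma linear_lower_bound:
  assumes m: "m \<in> S" "0 < m $ j"
  shows "\<exists>n0. \<forall>n\<ge>n0. \<exists>w \<in> S. w $ j = n \<and> (\<forall>i. (n - n0) * m $ i \<le> w $ i * m $ j)"
proof -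
  obtain s t where st: "s \<in> S" "t \<in> S" "s $ j = t $ j + 1" using consecutive by blast
  define d where "d = m $ j"
  have d: "0 < d" using m by (simp add: d_def)
  define n0 where "n0 = d * t $ j + d"
  have "\<exists>w \<in> S. w $ j = n \<and> (\<forall>i. (n - n0) * m $ i \<le> w $ i * m $ j)" if "n0 \<le> n" for n
  proof -
    define q where "q = (n - d * t $ j) div d"
    define \<rho> where "\<rho> = (n - d * t $ j) mod d"
    have \<rho>: "0 \<le> \<rho>" "\<rho> < d" using d by (auto simp: \<rho>_def)
    have eq: "q * d + \<rho> = n - d * t $ j" by (simp add: q_def \<rho>_def)
    have q: "0 \<le> q"
      using that d by (simp add: q_def n0_def pos_imp_zdiv_nonneg_iff)
    \<comment> \<open>The coefficients of \<open>s\<close> and \<open>t\<close> add up to \<open>d\<close>, so together these two summands contribute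
      \<open>d * t $ j + \<rho>\<close> at coordinate \<open>j\<close>.\<close>
    define w where "w = (\<chi> k. int (nat \<rho>) * s $ k) + (\<chi> k. int (nat (d - \<rho>)) * t $ k)
                        + (\<chi> k. int (nat q) * m $ k)"
    have w: "w $ k = \<rho> * s $ k + (d - \<rho>) * t $ k + q * m $ k" for k
      using \<rho> q by (simp add: w_def)
    have "w \<in> S" unfolding w_def using st m by (intro add_closed multiple_closed)
    moreover have "w $ j = n"
      using eq by (simp add: w st(3) d_def[symmetric] algebra_simps)
    moreover have "(n - n0) * m $ i \<le> w $ i * m $ j" for i
    proof -
      have "(n - n0) * m $ i \<le> (q * d) * m $ i"
        using eq \<rho> nonneg[OF m(1)] by (intro mult_right_mono) (auto simp: n0_def)
      also have "\<dots> = (q * m $ i) * d" by simp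
      also have "\<dots> \<le> w $ i * d"
        using \<rho> d nonneg[OF st(1)] nonneg[OF st(2)] by (intro mult_right_mono) (auto simp: w)
      finally show ?thesis by (simp add: d_def)
    qed
    ultimately show ?thesis by blast
  qed
  then show ?thesis by blast
qed

text \<open>Choose \<open>t\<close> and \<open>m\<close> in \<open>S\<close> such that \<open>t\<close> is steeper than \<open>m\<close> in the direction of \<open>j\<close> against \<open>i\<close>.
A large multiple \<open>s\<close> of \<open>t\<close> has a smaller coordinate \<open>i\<close> than some element of \<open>S\<close> with the
same coordinate \<open>j\<close> that follows the direction of \<open>m\<close>. Exchanging at \<open>j\<close> against such an
element keeps the coordinate \<open>i\<close> and raises the coordinate \<open>j\<close>, after which the same
comparison holds again; so this can be repeated forever.\<close>
lemma unbounded_beside_fixed: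
  assumes "i \<noteq> j"
  shows "\<exists>a. \<forall>N. \<exists>u \<in> S. u $ i = a \<and> N \<le> u $ j"
proof -
  obtain p where p: "p \<in> S" "\<And>k. 0 < p $ k" using positive by blast
  have "\<exists>m \<in> S. 0 < m $ i \<and> 0 < m $ j \<and> (\<exists>t \<in> S. t $ i * m $ j < t $ j * m $ i)"
  proof -
    obtain s t where st: "s \<in> S" "t \<in> S" "s $ i * t $ j \<noteq> s $ j * t $ i"
      using independent[OF assms] by blast
    have "\<exists>x \<in> S. x $ i * p $ j \<noteq> x $ j * p $ i"
    proof (rule ccontr)
      assume "\<not> ?thesis"
      then have x: "x $ i * p $ j = x $ j * p $ i" if "x \<in> S" for x using that by blast
      have "p $ i * p $ j * (s $ i * t $ j) = (s $ i * p $ j) * (t $ j * p $ i)"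
        by (simp add: mult_ac)
      also have "\<dots> = (s $ j * p $ i) * (t $ i * p $ j)"
        using x[OF st(1)] x[OF st(2)] by simp
      also have "\<dots> = p $ i * p $ j * (s $ j * t $ i)" by (simp add: mult_ac)
      finally show False using st(3) p(2)[of i] p(2)[of j] by simp
    qed
    then obtain x where x: "x \<in> S" "x $ i * p $ j \<noteq> x $ j * p $ i" by blast
    show ?thesis
    proof (cases "x $ i * p $ j < x $ j * p $ i")
      case True
      then show ?thesis using p x by blast
    next
      case False
      \<comment> \<open>Here \<open>p\<close> is the steeper element; \<open>x\<close> may have coordinates equal to \<open>0\<close>, so it is replaced
        by \<open>x + p\<close>.\<close>
      then have less: "p $ i * (x + p) $ j < p $ j * (x + p) $ i"
        using x(2) by (simp add: algebra_simps)
      have "0 < (x + p) $ k" for k using nonneg[OF x(1), of k] p(2)[of k] by simp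
      then show ?thesis using less p(1) add_closed[OF x(1) p(1)] by blast
    qed
  qed
  then obtain m t where m: "m \<in> S" "0 < m $ i" "0 < m $ j"
    and t: "t \<in> S" "t $ i * m $ j < t $ j * m $ i" by blast
  obtain n0 where n0: "\<And>n. n0 \<le> n \<Longrightarrow>
      \<exists>w \<in> S. w $ j = n \<and> (\<forall>i. (n - n0) * m $ i \<le> w $ i * m $ j)"
    using linear_lower_bound[OF m(1,3)] by blast
  \<comment> \<open>A factor exceeding \<open>n0 * m $ i\<close> absorbs the error term \<open>n0\<close> of the linear lower bound.\<close>
  define k where "k = nat (n0 * m $ i) + 1"
  define s where "s = (\<chi> l. int k * t $ l)"
  define a where "a = s $ i"
  have s: "s \<in> S" unfolding s_def by (rule multiple_closed[OF t(1)])
  have a: "0 \<le> a" using nonneg[OF s] by (simp add: a_def)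
  have start: "a * m $ j < (s $ j - n0) * m $ i"
  proof -
    have "n0 * m $ i < int k" by (simp add: k_def)
    also have "int k \<le> int k * (t $ j * m $ i - t $ i * m $ j)"
      using mult_left_mono[of 1 "t $ j * m $ i - t $ i * m $ j" "int k"] t(2) by simp
    also have "\<dots> = s $ j * m $ i - a * m $ j" by (simp add: s_def a_def algebra_simps)
    finally show ?thesis by (simp add: algebra_simps)
  qed
  have step: "\<exists>u' \<in> S. u' $ i = a \<and> u $ j < u' $ j"
    if u: "u \<in> S" "u $ i = a" "s $ j \<le> u $ j" for u
  proof -
    have less: "a * m $ j < (u $ j - n0) * m $ i"
      using start u(3) m(2) by (smt (verit) mult_right_mono)
    have "0 \<le> a * m $ j" using a m by simp
    with less have "0 < (u $ j - n0) * m $ i" by linarith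
    then have "n0 \<le> u $ j" using m(2) by (simp add: zero_less_mult_iff)
    then obtain w where w: "w \<in> S" "w $ j = u $ j" "(u $ j - n0) * m $ i \<le> w $ i * m $ j"
      using n0 by blast
    have "a < w $ i" using less w(3) m(3) by (metis mult_less_cancel_right_pos order_less_le_trans)
    moreover obtain g where "g \<in> S" "u $ j < g $ j"
        "\<And>k. u $ k \<noteq> w $ k \<Longrightarrow> g $ k = min (u $ k) (w $ k)"
      using exchange[OF u(1) w(1) w(2)[symmetric]] by blast
    ultimately show ?thesis using u(2) by (intro bexI[of _ g]) auto
  qed
  have "\<exists>u \<in> S. u $ i = a \<and> s $ j + int n \<le> u $ j" for n
  proof (induction n)
    case 0
    then show ?case using s a_def by auto
  next
    case (Suc n)
    then obtain u where "u \<in> S" "u $ i = a" "s $ j + int n \<le> u $ j" by blast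
    moreover from this obtain u' where "u' \<in> S" "u' $ i = a" "u $ j < u' $ j"
      using step[of u] by force
    ultimately show ?case by (intro bexI[of _ u']) auto
  qed
  then have large: "\<exists>u \<in> S. u $ i = a \<and> s $ j + int (nat (N - s $ j)) \<le> u $ j" for N
    by blast
  have "\<exists>u \<in> S. u $ i = a \<and> N \<le> u $ j" for N
  proof -
    have "N \<le> s $ j + int (nat (N - s $ j))" by simp
    then show ?thesis using large[of N] order_trans by blast
  qed
  then show ?thesis by blast
qed

lemma all_others_unbounded:
  "\<exists>a. \<forall>N. \<exists>u \<in> S. u $ i = a \<and> (\<forall>k. k \<noteq> i \<longrightarrow> N \<le> u $ k)"
proof -
  have "\<exists>a. \<forall>N. \<exists>u \<in> S. u $ i = a \<and> (\<forall>k \<in> A. N \<le> u $ k)" if "finite A" "i \<notin> A" for A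
    using that
  proof (induction A rule: finite_induct)
    case empty
    then show ?case using zero_mem by auto
  next
    case (insert j A)
    then obtain a where a: "\<And>N. \<exists>u \<in> S. u $ i = a \<and> (\<forall>k \<in> A. N \<le> u $ k)" by auto
    obtain b where b: "\<And>N. \<exists>u \<in> S. u $ i = b \<and> N \<le> u $ j"
      using unbounded_beside_fixed[of i j] insert.prems by auto
    have "\<exists>u \<in> S. u $ i = a + b \<and> (\<forall>k \<in> insert j A. N \<le> u $ k)" for N
    proof -
      obtain u where u: "u \<in> S" "u $ i = a" "\<And>k. k \<in> A \<Longrightarrow> N \<le> u $ k" using a by blast
      obtain w where w: "w \<in> S" "w $ i = b" "N \<le> w $ j" using b by blast
      have "N \<le> (u + w) $ k" if "k \<in> insert j A" for k
        using that u(3)[of k] w(3) nonneg[OF u(1), of k] nonneg[OF w(1), of k] by auto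
      then show ?thesis using u w add_closed by (intro bexI[of _ "u + w"]) auto
    qed
    then show ?case by blast
  qed
  from this[of "UNIV - {i}"] show ?thesis by (simp add: Ball_def)
qed

text \<open>A large \<open>\<beta>\<close> is the minimum over \<open>i\<close> of elements that equal \<open>\<beta>\<close> at coordinate \<open>i\<close> and are at
least \<open>\<beta>\<close> elsewhere. Such an element is the sum of one whose coordinate \<open>i\<close> is fixed and whose
other coordinates are as large as desired, and one whose coordinate \<open>i\<close> is the remainder.\<close>
lemma contains_orthant: "\<exists>\<gamma>. \<forall>\<beta>\<ge>\<gamma>. \<beta> \<in> S"
proof -
  obtain p where p: "p \<in> S" "\<And>k. 0 < p $ k" using positive by blast
  have "\<exists>n0. \<forall>n\<ge>n0. \<exists>w \<in> S. w $ i = n" for i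
    using linear_lower_bound[OF p(1), of i] p(2) by blast
  then obtain n0 where n0: "\<And>i n. n0 i \<le> n \<Longrightarrow> \<exists>w \<in> S. w $ i = n" by metis
  obtain a where a: "\<And>i N. \<exists>u \<in> S. u $ i = a i \<and> (\<forall>k. k \<noteq> i \<longrightarrow> N \<le> u $ k)"
    using all_others_unbounded by metis
  have "\<beta> \<in> S" if \<beta>: "(\<chi> i. n0 i + a i) \<le> \<beta>" for \<beta>
  proof -
    have "\<exists>b \<in> S. b $ i = \<beta> $ i \<and> (\<forall>k. \<beta> $ k \<le> b $ k)" for i
    proof -
      obtain u where u: "u \<in> S" "u $ i = a i" "\<And>k. k \<noteq> i \<Longrightarrow> Max (range (($) \<beta>)) \<le> u $ k"
        using a by metis
      have "n0 i \<le> \<beta> $ i - a i"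
        using \<beta> by (auto simp: less_eq_vec_def algebra_simps)
      then obtain w where w: "w \<in> S" "w $ i = \<beta> $ i - a i" using n0 by blast
      have "\<beta> $ k \<le> (w + u) $ k" for k
      proof (cases "k = i")
        case False
        have "\<beta> $ k \<le> Max (range (($) \<beta>))" by simp
        then have "\<beta> $ k \<le> u $ k" using u(3)[OF False] by (rule order_trans)
        then show ?thesis using nonneg[OF w(1), of k] by simp
      qed (use u w in simp)
      then show ?thesis using u w add_closed by (intro bexI[of _ "w + u"]) auto
    qed
    then obtain b where b: "\<And>i. b i \<in> S" "\<And>i. b i $ i = \<beta> $ i" "\<And>i k. \<beta> $ k \<le> b i $ k"
      by metis
    have "(\<chi> k. Min ((\<lambda>i. b i $ k) ` UNIV)) \<in> S" using b(1) by (intro Min_closed) auto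
    moreover have "Min ((\<lambda>i. b i $ k) ` UNIV) = \<beta> $ k" for k
      using b(2,3) by (intro Min_eqI) (auto intro: rev_image_eqI[of k])
    ultimately show ?thesis by simp
  qed
  then show ?thesis by blast
qed

end

section \<open>Rings carried by subsets of a commutative ring\<close>

lemma ring_of_type_algebra_simps [simp]:
  "carrier (ring_of_type_algebra :: 'a::comm_ring_1 ring) = UNIV"
  "x \<otimes>\<^bsub>(ring_of_type_algebra :: 'a ring)\<^esub> y = x * y"
  "x \<oplus>\<^bsub>(ring_of_type_algebra :: 'a ring)\<^esub> y = x + y"
  "\<one>\<^bsub>(ring_of_type_algebra :: 'a ring)\<^esub> = 1"
  "\<zero>\<^bsub>(ring_of_type_algebra :: 'a ring)\<^esub> = 0"
  by (simp_all add: ring_of_type_algebra_def)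

lemma ring_on_simps [simp]:
  "x \<otimes>\<^bsub>ring_on S\<^esub> y = x * y"
  "x \<oplus>\<^bsub>ring_on S\<^esub> y = x + y"
  "\<one>\<^bsub>ring_on S\<^esub> = 1"
  "\<zero>\<^bsub>ring_on S\<^esub> = 0"
  by (simp_all add: ring_of_type_algebra_def)

context
  fixes S :: "'a::comm_ring_1 set"
  assumes S: "subring S (ring_of_type_algebra :: 'a ring)"
begin

lemma subring_zero: "0 \<in> S" and subring_one: "1 \<in> S"
  and subring_add: "x \<in> S \<Longrightarrow> y \<in> S \<Longrightarrow> x + y \<in> S"
  and subring_mult: "x \<in> S \<Longrightarrow> y \<in> S \<Longrightarrow> x * y \<in> S"
  using subringE[OF S] by simp_all

lemma ring_on_cring: "cring (ring_on S)"
proof -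
  interpret Q: cring "ring_of_type_algebra :: 'a ring" by (rule cring_from_type_algebra)
  show ?thesis using Q.subcring_iff[of S] Q.subcringI'[OF S] by simp
qed

lemma subring_uminus: "x \<in> S \<Longrightarrow> - x \<in> S"
proof -
  interpret Q: cring "ring_of_type_algebra :: 'a ring" by (rule cring_from_type_algebra)
  have "\<ominus>\<^bsub>(ring_of_type_algebra :: 'a ring)\<^esub> x = - x"
    by (rule Q.minus_equality) simp_all
  then show "x \<in> S \<Longrightarrow> - x \<in> S" using subringE(5)[OF S, of x] by simp
qed

lemma ideal_ring_on_iff:
  "ideal N (ring_on S) \<longleftrightarrow>
    N \<subseteq> S \<and> 0 \<in> N \<and> (\<forall>x\<in>N. \<forall>y\<in>N. x + y \<in> N) \<and> (\<forall>a\<in>S. \<forall>x\<in>N. a * x \<in> N)"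
proof
  assume "ideal N (ring_on S)"
  then interpret N: ideal N "ring_on S" .
  show "N \<subseteq> S \<and> 0 \<in> N \<and> (\<forall>x\<in>N. \<forall>y\<in>N. x + y \<in> N) \<and> (\<forall>a\<in>S. \<forall>x\<in>N. a * x \<in> N)"
    using N.a_subset additive_subgroup.zero_closed[OF N.additive_subgroup_axioms]
      additive_subgroup.a_closed[OF N.additive_subgroup_axioms] N.I_l_closed by simp
next
  interpret S: cring "ring_on S" by (rule ring_on_cring)
  assume N: "N \<subseteq> S \<and> 0 \<in> N \<and> (\<forall>x\<in>N. \<forall>y\<in>N. x + y \<in> N) \<and> (\<forall>a\<in>S. \<forall>x\<in>N. a * x \<in> N)"
  show "ideal N (ring_on S)"
  proof (rule idealI)
    show "ring (ring_on S)" by (rule S.ring_axioms)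
    show "subgroup N (add_monoid (ring_on S))"
    proof (rule S.add.subgroupI)
      fix x assume x: "x \<in> N"
      have "\<ominus>\<^bsub>ring_on S\<^esub> x = - x"
        using N x subring_uminus by (intro S.minus_equality) auto
      also have "\<dots> \<in> N" using N x subring_uminus[OF subring_one] by fastforce
      finally show "\<ominus>\<^bsub>ring_on S\<^esub> x \<in> N" .
    qed (use N in auto)
    show "a \<otimes>\<^bsub>ring_on S\<^esub> x \<in> N" "x \<otimes>\<^bsub>ring_on S\<^esub> a \<in> N"
      if "a \<in> N" "x \<in> carrier (ring_on S)" for a x
      using N that by (auto simp: mult.commute[of a x])
  qed
qed

text \<open>Krull's theorem for a principal ideal: Zorn's lemma applied to the ideals that contain \<open>x\<close>
but not \<open>1\<close>.\<close>
lemma nonunit_in_maximalideal: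
  assumes x: "x \<in> S" and nonunit: "\<And>y. y \<in> S \<Longrightarrow> y * x \<noteq> 1"
  shows "\<exists>N. maximalideal N (ring_on S) \<and> x \<in> N"
proof -
  define A where "A = {N. ideal N (ring_on S) \<and> x \<in> N \<and> 1 \<notin> N}"
  have "(\<lambda>y. y * x) ` S \<in> A"
  proof -
    have "ideal ((\<lambda>y. y * x) ` S) (ring_on S)"
      unfolding ideal_ring_on_iff
    proof (intro conjI ballI)
      show "(\<lambda>y. y * x) ` S \<subseteq> S" using x subring_mult by auto
      show "0 \<in> (\<lambda>y. y * x) ` S" using subring_zero by force
      show "a + b \<in> (\<lambda>y. y * x) ` S" if "a \<in> (\<lambda>y. y * x) ` S" "b \<in> (\<lambda>y. y * x) ` S" for a b
        using that subring_add by (force simp: distrib_right[symmetric])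
      show "a * b \<in> (\<lambda>y. y * x) ` S" if "a \<in> S" "b \<in> (\<lambda>y. y * x) ` S" for a b
        using that subring_mult by (force simp: mult.assoc[symmetric])
    qed
    moreover have "x \<in> (\<lambda>y. y * x) ` S" using subring_one by force
    moreover have "1 \<notin> (\<lambda>y. y * x) ` S" using nonunit by force
    ultimately show ?thesis by (simp add: A_def)
  qed
  moreover have "\<Union>C \<in> A" if "C \<noteq> {}" "subset.chain A C" for C
  proof -
    have C: "C \<subseteq> A" "\<And>N N'. N \<in> C \<Longrightarrow> N' \<in> C \<Longrightarrow> N \<subseteq> N' \<or> N' \<subseteq> N"
      using that(2) by (auto simp: subset_chain_def)
    have id: "N \<subseteq> S" "0 \<in> N" "\<And>x y. x \<in> N \<Longrightarrow> y \<in> N \<Longrightarrow> x + y \<in> N"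
      "\<And>a x. a \<in> S \<Longrightarrow> x \<in> N \<Longrightarrow> a * x \<in> N" if "N \<in> C" for N
      using C(1) that unfolding A_def ideal_ring_on_iff by auto
    have "ideal (\<Union>C) (ring_on S)"
      unfolding ideal_ring_on_iff
    proof (intro conjI ballI)
      show "\<Union>C \<subseteq> S" using id(1) by blast
      show "0 \<in> \<Union>C" using id(2) that(1) by blast
      show "a * b \<in> \<Union>C" if "a \<in> S" "b \<in> \<Union>C" for a b using id(4) that by blast
      fix a b assume "a \<in> \<Union>C" "b \<in> \<Union>C"
      then obtain N N' where N: "N \<in> C" "a \<in> N" "N' \<in> C" "b \<in> N'" by blast
      show "a + b \<in> \<Union>C"
        using C(2)[OF N(1,3)] id(3)[OF N(1), of a b] id(3)[OF N(3), of a b] N by blast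
    qed
    then show ?thesis using that(1) C(1) by (auto simp: A_def)
  qed
  ultimately obtain N where N: "N \<in> A" "\<And>N'. N' \<in> A \<Longrightarrow> N \<subseteq> N' \<Longrightarrow> N' = N"
    using subset_Zorn_nonempty[of A] by blast
  have "maximalideal N (ring_on S)"
  proof (rule maximalidealI)
    show "ideal N (ring_on S)" using N by (simp add: A_def)
    show "carrier (ring_on S) \<noteq> N" using N subring_one by (auto simp: A_def)
    fix N' assume N': "ideal N' (ring_on S)" "N \<subseteq> N'" "N' \<subseteq> carrier (ring_on S)"
    show "N' = N \<or> N' = carrier (ring_on S)"
    proof (cases "1 \<in> N'")
      case True
      then have "a \<in> N'" if "a \<in> S" for a
        using N'(1) that unfolding ideal_ring_on_iff by force
      then show ?thesis using N'(3) by auto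
    next
      case False
      then show ?thesis using N N' by (auto simp: A_def)
    qed
  qed
  then show ?thesis using N by (auto simp: A_def)
qed

lemma coset_ring_on: "N +>\<^bsub>ring_on S\<^esub> x = (\<lambda>n. n + x) ` N"
  by (auto simp: a_r_coset_def r_coset_def)

lemma carrier_quot_ring_on: "carrier (ring_on S Quot N) = (\<lambda>x. N +>\<^bsub>ring_on S\<^esub> x) ` S"
  by (auto simp: FactRing_def A_RCOSETS_def RCOSETS_def a_r_coset_def)

end

text \<open>The ascending chain condition for the ideals generated by initial segments of a sequence.\<close>
lemma noetherian_relation:
  fixes S :: "'a::comm_ring_1 set"
  assumes S: "subring S (ring_of_type_algebra :: 'a ring)"
    and noeth: "noetherian_ring (ring_on S)" and y: "\<And>k::nat. y k \<in> S"
  shows "\<exists>n c. (\<forall>k<n. c k \<in> S) \<and> y n = (\<Sum>k<n. c k * y k)"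
proof -
  define L where "L n = {\<Sum>k<n. c k * y k |c. \<forall>k<n. c k \<in> S}" for n
  have sum_S: "(\<Sum>k<n. c k * y k) \<in> S" if "\<forall>k<n. c k \<in> S" for n c
    using that
    by (induction n) (auto intro: subring_zero[OF S] subring_add[OF S] subring_mult[OF S] y)
  have ideal_L: "ideal (L n) (ring_on S)" for n
    unfolding ideal_ring_on_iff[OF S]
  proof (intro conjI ballI)
    show "L n \<subseteq> S" using sum_S by (auto simp: L_def)
    show "0 \<in> L n" unfolding L_def using subring_zero[OF S] by (intro CollectI exI[of _ "\<lambda>_. 0"]) auto
    fix a b assume "b \<in> L n"
    then obtain c where c: "b = (\<Sum>k<n. c k * y k)" "\<forall>k<n. c k \<in> S" by (auto simp: L_def)
    show "a * b \<in> L n" if "a \<in> S"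
      unfolding L_def using c that subring_mult[OF S]
      by (intro CollectI exI[of _ "\<lambda>k. a * c k"]) (auto simp: sum_distrib_left mult.assoc)
    assume "a \<in> L n"
    then obtain d where d: "a = (\<Sum>k<n. d k * y k)" "\<forall>k<n. d k \<in> S" by (auto simp: L_def)
    show "a + b \<in> L n"
      unfolding L_def using c d subring_add[OF S]
      by (intro CollectI exI[of _ "\<lambda>k. d k + c k"]) (auto simp: sum.distrib distrib_right)
  qed
  have step: "L n \<subseteq> L (Suc n)" for n
  proof
    fix a assume "a \<in> L n"
    then obtain c where c: "a = (\<Sum>k<n. c k * y k)" "\<forall>k<n. c k \<in> S" by (auto simp: L_def)
    then have "a = (\<Sum>k<Suc n. (c(n := 0)) k * y k)" by simp
    moreover have "\<forall>k<Suc n. (c(n := 0)) k \<in> S" using c(2) subring_zero[OF S] by (simp add: less_Suc_eq)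
    ultimately show "a \<in> L (Suc n)" unfolding L_def by blast
  qed
  have mono: "L k \<subseteq> L n" if "k \<le> n" for k n
    using lift_Suc_mono_le[of L, OF step that] .
  have "subset.chain {I. ideal I (ring_on S)} (range L)"
    unfolding subset_chain_def
  proof (intro conjI ballI)
    fix A B assume "A \<in> range L" "B \<in> range L"
    then obtain k n where "A = L k" "B = L n" by blast
    then show "A \<subseteq> B \<or> B \<subseteq> A" using mono[of k n] mono[of n k] nat_le_linear[of k n] by blast
  qed (use ideal_L in blast)
  then have "\<Union>(range L) \<in> range L"
    using noetherian_ring.ideal_chain_is_trivial[OF noeth] by blast
  then obtain n where n: "\<Union>(range L) = L n" by auto
  have "y n = (\<Sum>k<Suc n. (if k = n then 1 else 0) * y k)" by simp
  moreover have "\<forall>k<Suc n. (if k = n then 1 else 0) \<in> S"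
    using subring_zero[OF S] subring_one[OF S] by simp
  ultimately have "y n \<in> L (Suc n)"
    unfolding L_def by (intro CollectI exI[of _ "\<lambda>k. if k = n then 1 else 0"] conjI)
  then have "y n \<in> L n" using n by blast
  then show ?thesis unfolding L_def by blast
qed

section \<open>The valuations of an admissible ring\<close>

locale admissible_valuations =
  fixes R M :: "'a::comm_ring_1 set"
    and V :: "'r::finite \<Rightarrow> 'a set"
    and v :: "'r \<Rightarrow> 'a \<Rightarrow> int"
  assumes admissible: "admissible_ring R M"
    and V_bij: "bij_betw V UNIV (valuation_rings R)"
    and valuation: "\<And>i. discrete_valuation_of (V i) (v i)"
begin

lemma R_subring: "subring R (ring_of_type_algebra :: 'a ring)"
  using admissible by (simp add: admissible_ring_def has_total_ring_of_fractions_def subcring_def)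

lemmas R_zero = subring_zero[OF R_subring]
  and R_one = subring_one[OF R_subring]
  and R_add = subring_add[OF R_subring]
  and R_mult = subring_mult[OF R_subring]
  and R_uminus = subring_uminus[OF R_subring]

lemma R_power: "x \<in> R \<Longrightarrow> x ^ n \<in> R"
  by (induction n) (auto intro: R_one R_mult)

lemma regular_R_unit: "s \<in> regular_elements (ring_on R) \<Longrightarrow> s dvd 1"
  using admissible by (simp add: admissible_ring_def has_total_ring_of_fractions_def)

text \<open>The numerator of a regular fraction is regular, and the regular elements of \<open>R\<close> are
invertible.\<close>
lemma Q_reg_iff: "(x :: 'a) \<in> Q_reg \<longleftrightarrow> x dvd 1"
proof
  assume x: "x \<in> Q_reg"
  obtain a s where as: "a \<in> R" "s \<in> regular_elements (ring_on R)" "s * x = a"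
    using admissible unfolding admissible_ring_def has_total_ring_of_fractions_def by blast
  obtain s' where s': "1 = s * s'" using regular_R_unit[OF as(2)] by (rule dvdE)
  have "y = 0" if "a * y = 0" for y
  proof -
    have "x * y = s' * (a * y)"
      using as(3) s' by (metis mult.assoc mult.commute mult_1)
    then have "x * y = 0" using that by simp
    then show ?thesis using x by (simp add: Q_reg_def regular_elements_def)
  qed
  then have "a \<in> regular_elements (ring_on R)" using as(1) by (simp add: regular_elements_def)
  then have "s * x dvd 1" using regular_R_unit as(3) by blast
  then show "x dvd 1" by (rule dvd_mult_right)
next
  assume "x dvd 1"
  then obtain x' where "1 = x * x'" by (rule dvdE)
  then have "x * y = 0 \<Longrightarrow> y = 0" for y by (metis mult.assoc mult.commute mult_1 mult_zero_right)
  then show "x \<in> Q_reg" by (simp add: Q_reg_def regular_elements_def)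
qed

lemma Q_reg_mult [simp]: "(x :: 'a) * y \<in> Q_reg \<longleftrightarrow> x \<in> Q_reg \<and> y \<in> Q_reg"
  unfolding Q_reg_iff using mult_dvd_mono[of x 1 y 1] dvd_mult_left dvd_mult_right by auto

lemma Q_reg_one [simp]: "(1 :: 'a) \<in> Q_reg"
  by (simp add: Q_reg_iff)

lemma Q_reg_uminus [simp]: "- (x :: 'a) \<in> Q_reg \<longleftrightarrow> x \<in> Q_reg"
  by (simp add: Q_reg_iff)

lemma Q_reg_power: "(x :: 'a) \<in> Q_reg \<Longrightarrow> x ^ n \<in> Q_reg"
  by (induction n) auto

lemma Q_reg_prod: "(\<And>k. k \<in> A \<Longrightarrow> (f k :: 'a) \<in> Q_reg) \<Longrightarrow> prod f A \<in> Q_reg"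
  by (induction A rule: infinite_finite_induct) auto

lemma Q_reg_cancel: "(x :: 'a) \<in> Q_reg \<Longrightarrow> x * y = 0 \<Longrightarrow> y = 0"
  by (simp add: Q_reg_def regular_elements_def)

lemma Q_reg_inverse: "(x :: 'a) \<in> Q_reg \<Longrightarrow> \<exists>y \<in> Q_reg. x * y = 1"
  by (metis Q_reg_iff dvdE dvd_triv_right)

lemma Q_reg_fraction: "\<exists>a \<in> R. \<exists>s \<in> R. s \<in> Q_reg \<and> s * x = a"
proof -
  obtain a s where "a \<in> R" "s \<in> regular_elements (ring_on R)" "s * x = a"
    using admissible unfolding admissible_ring_def has_total_ring_of_fractions_def by blast
  then show ?thesis using regular_R_unit[of s] by (auto simp: Q_reg_iff regular_elements_def)
qed

lemma M_maximal: "maximalideal M (ring_on R)" "maximalideal N (ring_on R) \<Longrightarrow> N = M"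
  and R_noetherian: "noetherian_ring (ring_on R)"
  using admissible unfolding admissible_ring_def cohen_macaulay_local_def local_ring_def by auto

lemma M_ideal: "ideal M (ring_on R)"
  using M_maximal(1) by (rule maximalideal.axioms(1))

lemma M_R: "x \<in> M \<Longrightarrow> x \<in> R"
  and M_add: "x \<in> M \<Longrightarrow> y \<in> M \<Longrightarrow> x + y \<in> M"
  and M_mult: "a \<in> R \<Longrightarrow> x \<in> M \<Longrightarrow> a * x \<in> M"
  using M_ideal unfolding ideal_ring_on_iff[OF R_subring] by auto

lemma M_power: "x \<in> M \<Longrightarrow> 0 < n \<Longrightarrow> x ^ n \<in> M"
  using M_mult[of "x ^ (n - 1)" x] R_power[of x "n - 1"] M_R[of x]
  by (cases n) (auto simp: mult.commute)

lemma M_uminus: "x \<in> M \<Longrightarrow> - x \<in> M"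
  using M_mult[of "-1" x] R_uminus[OF R_one] by simp

lemma M_diff: "x \<in> M \<Longrightarrow> y \<in> M \<Longrightarrow> x - y \<in> M"
  using M_add[of x "- y"] M_uminus[of y] by simp

lemma one_notin_M: "1 \<notin> M"
proof
  assume "1 \<in> M"
  then have "M = R" using M_mult[of _ 1] M_R by force
  then show False using maximalideal.I_notcarr[OF M_maximal(1)] by simp
qed

lemma unit_outside_M:
  assumes "x \<in> R" "x \<notin> M"
  shows "\<exists>y \<in> R. y * x = 1"
proof (rule ccontr)
  assume "\<not> ?thesis"
  then obtain N where "maximalideal N (ring_on R)" "x \<in> N"
    using nonunit_in_maximalideal[OF R_subring assms(1)] by blast
  then show False using M_maximal(2) assms(2) by blast
qed

lemma regular_outside_M: "x \<in> R \<Longrightarrow> x \<notin> M \<Longrightarrow> x \<in> Q_reg"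
  using unit_outside_M[of x] by (metis Q_reg_iff dvd_triv_right)

subsection \<open>Elementary properties of the valuations\<close>

lemma V_subring: "subring (V i) (ring_of_type_algebra :: 'a ring)"
  and R_sub_V: "R \<subseteq> V i"
  using V_bij by (auto simp: bij_betw_def valuation_rings_def)

lemma V_inj: "V i = V j \<Longrightarrow> i = j"
  using V_bij by (auto simp: bij_betw_def inj_on_def)

lemma v_mult: "x \<in> Q_reg \<Longrightarrow> y \<in> Q_reg \<Longrightarrow> v i (x * y) = v i x + v i y"
  and v_add: "x \<in> Q_reg \<Longrightarrow> y \<in> Q_reg \<Longrightarrow> x + y \<in> Q_reg \<Longrightarrow> min (v i x) (v i y) \<le> v i (x + y)"
  and V_iff: "x \<in> Q_reg \<Longrightarrow> x \<in> V i \<longleftrightarrow> 0 \<le> v i x"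
  and v_surj: "\<exists>x \<in> Q_reg. v i x = n"
  using valuation[of i] unfolding discrete_valuation_of_def by (auto simp: image_iff) (metis UNIV_I imageE)

lemma v_one [simp]: "v i 1 = 0"
  using v_mult[of 1 1 i] by simp

lemma v_uminus: "x \<in> Q_reg \<Longrightarrow> v i (- x) = v i x"
  using v_mult[of "-1" "-1" i] v_mult[of "-1" x i] by simp

lemma v_add_eq:
  assumes "x \<in> Q_reg" "y \<in> Q_reg" "x + y \<in> Q_reg" "v i x \<noteq> v i y"
  shows "v i (x + y) = min (v i x) (v i y)"
  using v_add[of x y i] v_add[of "x + y" "- x" i] v_add[of "x + y" "- y" i]
    v_uminus[of x i] v_uminus[of y i] assms by (auto simp: min_def split: if_splits)

lemma v_diff: "x \<in> Q_reg \<Longrightarrow> y \<in> Q_reg \<Longrightarrow> x - y \<in> Q_reg \<Longrightarrow> min (v i x) (v i y) \<le> v i (x - y)"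
  using v_add[of x "- y" i] v_uminus[of y i] by simp

lemma v_nonneg: "x \<in> R \<Longrightarrow> x \<in> Q_reg \<Longrightarrow> 0 \<le> v i x"
  using R_sub_V V_iff by blast

text \<open>The regular maximal ideal \<open>N\<close> of \<open>V\<^sub>i\<close>, obtained as a maximal ideal containing an element of
value \<open>1\<close>. A regular element of value \<open>0\<close> is a unit of \<open>V\<^sub>i\<close>, and one of positive value is a
multiple of the element of value \<open>1\<close>, so \<open>N\<close> consists, as far as regular elements
are concerned, of those of positive value. The remaining two clauses are residual
rationality.\<close>
lemma residue_ideal:
  "\<exists>N. ideal N (ring_on (V i)) \<and> N \<inter> R = M \<and> (\<forall>x \<in> Q_reg. x \<in> N \<longleftrightarrow> 0 < v i x) \<and>
     (\<forall>y \<in> V i. \<exists>u \<in> R. y - u \<in> N)"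
proof -
  obtain t where t: "t \<in> Q_reg" "v i t = 1" using v_surj by blast
  have "t \<in> V i" using t V_iff by simp
  moreover have "y * t \<noteq> 1" if "y \<in> V i" for y
  proof
    assume yt: "y * t = 1"
    then have "y \<in> Q_reg" using Q_reg_mult[of y t] by simp
    then have "v i y + v i t = 0" using v_mult[of y t i] t yt by simp
    then show False using V_iff \<open>y \<in> Q_reg\<close> that t by simp
  qed
  ultimately obtain N where max: "maximalideal N (ring_on (V i))" and tN: "t \<in> N"
    using nonunit_in_maximalideal[OF V_subring] by blast
  have N: "ideal N (ring_on (V i))" using max by (rule maximalideal.axioms(1))
  then have N_V: "N \<subseteq> V i" and N_mult: "\<And>a x. a \<in> V i \<Longrightarrow> x \<in> N \<Longrightarrow> a * x \<in> N"
    unfolding ideal_ring_on_iff[OF V_subring] by auto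
  have one: "1 \<notin> N"
  proof
    assume "1 \<in> N"
    then have "N = V i" using N_mult[of _ 1] N_V by force
    then show False using maximalideal.I_notcarr[OF max] by simp
  qed
  have res: "N \<inter> R = M" "(\<lambda>x. N +>\<^bsub>ring_on (V i)\<^esub> x) ` R = carrier (ring_on (V i) Quot N)"
  proof -
    have "V i \<in> valuation_rings R" using V_bij by (auto simp: bij_betw_def)
    moreover have "maximalideal N (ring_on (V i)) \<and> N \<inter> Q_reg \<noteq> {}" using max tN t(1) by blast
    moreover have "residually_rational R M" using admissible by (simp add: admissible_ring_def)
    ultimately show "N \<inter> R = M" "(\<lambda>x. N +>\<^bsub>ring_on (V i)\<^esub> x) ` R = carrier (ring_on (V i) Quot N)"
      unfolding residually_rational_def by blast+
  qed
  have positive: "x \<in> N \<longleftrightarrow> 0 < v i x" if x: "x \<in> Q_reg" for x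
  proof
    assume xN: "x \<in> N"
    then have "0 \<le> v i x" using x N_V V_iff by blast
    moreover have "v i x \<noteq> 0"
    proof
      assume v0: "v i x = 0"
      obtain y where y: "y \<in> Q_reg" "x * y = 1" using Q_reg_inverse[OF x] by blast
      then have "v i y = 0" using v_mult[OF x y(1), of i] v0 by simp
      then have "y * x \<in> N" using N_mult xN y V_iff by simp
      then show False using y one by (simp add: mult.commute)
    qed
    ultimately show "0 < v i x" by simp
  next
    assume pos: "0 < v i x"
    obtain y where y: "y \<in> Q_reg" "t * y = 1" using Q_reg_inverse[OF t(1)] by blast
    then have "v i y = - 1" using v_mult[OF t(1) y(1), of i] t by simp
    then have "x * y \<in> V i" using pos v_mult[OF x y(1), of i] x y V_iff by simp
    then have "(x * y) * t \<in> N" using N_mult tN by blast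
    also have "(x * y) * t = x * (t * y)" by (simp only: mult_ac)
    also have "\<dots> = x" using y(2) by simp
    finally show "x \<in> N" .
  qed
  have residue: "\<exists>u \<in> R. y - u \<in> N" if "y \<in> V i" for y
  proof -
    have "N +>\<^bsub>ring_on (V i)\<^esub> y \<in> (\<lambda>x. N +>\<^bsub>ring_on (V i)\<^esub> x) ` R"
      unfolding res(2) carrier_quot_ring_on[OF V_subring] using that by (rule imageI)
    then obtain u where u: "u \<in> R" "(\<lambda>n. n + y) ` N = (\<lambda>n. n + u) ` N"
      unfolding coset_ring_on[OF V_subring] by blast
    have "0 \<in> N" using N unfolding ideal_ring_on_iff[OF V_subring] by blast
    then have "y \<in> (\<lambda>n. n + y) ` N" by force
    then obtain n where "n \<in> N" "y = n + u" using u(2) by blast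
    then show ?thesis using u(1) by (intro bexI[of _ u]) auto
  qed
  show ?thesis using N res(1) positive residue by (intro exI[of _ N] conjI ballI)
qed

lemma in_M_iff: "x \<in> R \<Longrightarrow> x \<in> Q_reg \<Longrightarrow> x \<in> M \<longleftrightarrow> 0 < v i x"
  using residue_ideal[of i] by blast

lemma v_outside_M: "x \<in> R \<Longrightarrow> x \<notin> M \<Longrightarrow> v i x = 0"
  using in_M_iff[of x i] v_nonneg[of x i] regular_outside_M[of x] by auto

text \<open>In a fraction of value \<open>1\<close> the numerator has larger value than the denominator, hence
positive value.\<close>
lemma regular_in_M: "\<exists>m \<in> M. m \<in> Q_reg"
proof -
  fix i
  obtain t where t: "t \<in> Q_reg" "v i t = 1" using v_surj by blast
  obtain a s where as: "a \<in> R" "s \<in> R" "s \<in> Q_reg" "s * t = a" using Q_reg_fraction by blast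
  have a: "a \<in> Q_reg" using as t by auto
  have "0 < v i a" using v_mult[OF as(3) t(1), of i] as t v_nonneg[OF as(2,3), of i] by simp
  then show ?thesis using in_M_iff as(1) a by blast
qed

subsection \<open>Moving into the regular elements\<close>

text \<open>If \<open>x + m\<^sup>n\<close> is a zero divisor, it kills some \<open>y\<^sub>n \<noteq> 0\<close> in \<open>R\<close>, that is, \<open>y\<^sub>n\<close> is an eigenvector
of multiplication by \<open>x\<close> with eigenvalue \<open>- m\<^sup>n\<close>. Distinct eigenvalues differ by a regular
element, because \<open>1 - m\<^sup>d\<close> is a unit of the local ring \<open>R\<close> for \<open>d > 0\<close>. As in linear algebra,
such eigenvectors are independent over \<open>R\<close>, and a noetherian ring admits no infinite
independent sequence.\<close>
lemma finite_nonregular: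
  assumes m: "m \<in> M" "m \<in> Q_reg"
  shows "finite {n. x + m ^ n \<notin> Q_reg}"
proof (rule ccontr)
  assume "infinite {n. x + m ^ n \<notin> Q_reg}"
  then obtain e :: "nat \<Rightarrow> nat" where e: "strict_mono e" "\<And>k. x + m ^ e k \<notin> Q_reg"
    using infinite_enumerate by blast
  have "\<exists>y \<in> R. y \<noteq> 0 \<and> (x + m ^ e k) * y = 0" for k
  proof -
    obtain z where z: "z \<noteq> 0" "(x + m ^ e k) * z = 0"
      using e(2)[of k] by (auto simp: Q_reg_def regular_elements_def)
    obtain a s where as: "a \<in> R" "s \<in> Q_reg" "s * z = a" using Q_reg_fraction by blast
    have "a \<noteq> 0" using as z(1) Q_reg_cancel by blast
    moreover have "(x + m ^ e k) * a = s * ((x + m ^ e k) * z)"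
      unfolding as(3)[symmetric] by (simp only: mult_ac)
    ultimately show ?thesis using z(2) as(1) by auto
  qed
  then obtain y where y: "\<And>k. y k \<in> R" "\<And>k. y k \<noteq> 0" "\<And>k. (x + m ^ e k) * y k = 0"
    by metis
  obtain n c where n: "y n = (\<Sum>k<n. c k * y k)"
    using noetherian_relation[OF R_subring R_noetherian, of y] y(1) by blast
  \<comment> \<open>\<open>p\<close> kills every \<open>y k\<close> with \<open>k < n\<close>, but acts on \<open>y n\<close> as a regular element.\<close>
  define p where "p = (\<Prod>k<n. x + m ^ e k)"
  have "p * y k = 0" if "k < n" for k
  proof -
    have "p = (\<Prod>l\<in>{..<n} - {k}. x + m ^ e l) * (x + m ^ e k)"
      unfolding p_def using that by (subst prod.remove[of _ k]) (auto simp: mult.commute)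
    then show ?thesis using y(3)[of k] by (simp add: mult.assoc)
  qed
  then have "p * (c k * y k) = 0" if "k < n" for k
    using that by (simp only: mult.left_commute[of p]) simp
  then have "p * y n = 0"
    by (subst n) (auto simp: sum_distrib_left intro!: sum.neutral)
  moreover have "(\<Prod>k<j. x + m ^ e k) * y n = (\<Prod>k<j. m ^ e k - m ^ e n) * y n" for j
  proof (induction j)
    case (Suc j)
    have "x * y n = - (m ^ e n * y n)" using y(3)[of n] by (simp add: distrib_right eq_neg_iff_add_eq_0)
    then have xy: "(x + m ^ e j) * y n = (m ^ e j - m ^ e n) * y n" by (simp add: algebra_simps)
    have "(\<Prod>k<Suc j. x + m ^ e k) * y n = (\<Prod>k<j. x + m ^ e k) * ((x + m ^ e j) * y n)"
      by (simp add: mult.assoc)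
    also have "\<dots> = (m ^ e j - m ^ e n) * ((\<Prod>k<j. x + m ^ e k) * y n)"
      unfolding xy by (simp add: mult_ac)
    also have "\<dots> = (\<Prod>k<Suc j. m ^ e k - m ^ e n) * y n"
      unfolding Suc.IH by (simp add: mult_ac)
    finally show ?case .
  qed simp
  ultimately have "(\<Prod>k<n. m ^ e k - m ^ e n) * y n = 0" by (simp add: p_def)
  moreover have "(\<Prod>k<n. m ^ e k - m ^ e n) \<in> Q_reg"
  proof (rule Q_reg_prod)
    fix k assume "k \<in> {..<n}"
    then have less: "e k < e n" using e(1) by (simp add: strict_mono_less)
    have pow: "m ^ (e n - e k) \<in> M" using M_power m less by simp
    have "1 - m ^ (e n - e k) \<notin> M" using M_add[OF _ pow, of "1 - m ^ (e n - e k)"] one_notin_M by auto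
    moreover have "1 - m ^ (e n - e k) \<in> R"
      using R_add[OF R_one R_uminus[OF M_R[OF pow]]] by simp
    ultimately have "1 - m ^ (e n - e k) \<in> Q_reg" by (intro regular_outside_M)
    moreover have "m ^ e k - m ^ e n = m ^ e k * (1 - m ^ (e n - e k))"
      using less by (simp add: right_diff_distrib power_add[symmetric])
    ultimately show "m ^ e k - m ^ e n \<in> Q_reg" using Q_reg_power m by simp
  qed
  ultimately show False using Q_reg_cancel y(2) by blast
qed

lemma finite_nonregular_line:
  assumes m: "m \<in> M" "m \<in> Q_reg" and h: "h \<in> Q_reg"
  shows "finite {n. z + m ^ n * h \<notin> Q_reg}"
proof -
  obtain h' where h': "h * h' = 1" using Q_reg_inverse[OF h] by blast
  have "z + m ^ n * h = h * (z * h' + m ^ n)" for n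
  proof -
    have "h * (z * h' + m ^ n) = z * (h * h') + m ^ n * h" by (simp add: algebra_simps)
    then show ?thesis using h' by simp
  qed
  then have "{n. z + m ^ n * h \<notin> Q_reg} = {n. z * h' + m ^ n \<notin> Q_reg}" using h by simp
  then show ?thesis using finite_nonregular[OF m] by simp
qed

text \<open>The values are defined only on regular elements, so every linear combination whose value
matters must be made regular. This is possible without changing the residue class of the
coefficient, by adding to it a power of a regular element of the maximal ideal.\<close>
lemma regular_perturbation:
  assumes "h \<in> Q_reg" "u \<in> R"
  shows "\<exists>w \<in> R. w \<in> Q_reg \<and> w - u \<in> M \<and> z + w * h \<in> Q_reg"
proof -
  obtain m where m: "m \<in> M" "m \<in> Q_reg" using regular_in_M by blast
  have "finite ({n. u + m ^ n \<notin> Q_reg} \<union> {n. (z + u * h) + m ^ n * h \<notin> Q_reg} \<union> {0})"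
    using finite_nonregular[OF m] finite_nonregular_line[OF m assms(1)] by simp
  from ex_new_if_finite[OF infinite_UNIV_nat this]
  obtain n where n: "u + m ^ n \<in> Q_reg" "(z + u * h) + m ^ n * h \<in> Q_reg" "0 < n" by auto
  have "m ^ n \<in> M" using M_power m n by blast
  then show ?thesis using n(1,2) assms(2)
    by (intro bexI[of _ "u + m ^ n"] conjI) (auto simp: algebra_simps intro: R_add M_R)
qed

text \<open>A valuation ring is determined by its regular elements, since each of its elements becomes
regular after adding a suitable element of \<open>R\<close>.\<close>
lemma V_separated:
  assumes "i \<noteq> j"
  shows "\<exists>x \<in> Q_reg. (0 \<le> v i x) \<noteq> (0 \<le> v j x)"
proof (rule ccontr)
  assume neg: "\<not> ?thesis"
  have "V i \<subseteq> V j" if same: "\<And>x. x \<in> Q_reg \<Longrightarrow> 0 \<le> v i x \<longleftrightarrow> 0 \<le> v j x" for i j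
  proof
    fix x assume x: "x \<in> V i"
    obtain w where w: "w \<in> R" "x + w * 1 \<in> Q_reg"
      using regular_perturbation[OF Q_reg_one R_zero] by blast
    have "x + w \<in> V i" using x w R_sub_V subring_add[OF V_subring] by blast
    then have "x + w \<in> V j" using w same V_iff by simp
    moreover have "- w \<in> V j" using w R_uminus R_sub_V by blast
    ultimately have "x + w + - w \<in> V j" using subring_add[OF V_subring] by blast
    then show "x \<in> V j" by simp
  qed
  from this[of i j] this[of j i] have "V i = V j" using neg by blast
  then show False using V_inj assms by blast
qed

lemma residue_representatives:
  "\<exists>c :: 'r \<Rightarrow> 'a. (\<forall>i. c i \<in> R) \<and> (\<forall>i j. i \<noteq> j \<longrightarrow> c i - c j \<notin> M)"
proof -
  obtain f where f: "inj_on f (valuation_rings R)" "f ` valuation_rings R \<subseteq> carrier (ring_on R Quot M)"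
    using admissible unfolding admissible_ring_def lepoll_def by blast
  have V: "V i \<in> valuation_rings R" for i using V_bij by (auto simp: bij_betw_def)
  have "\<exists>c \<in> R. f (V i) = (\<lambda>n. n + c) ` M" for i
    using f(2) V[of i] unfolding carrier_quot_ring_on[OF R_subring] coset_ring_on[OF R_subring] by blast
  then obtain c where c: "\<And>i. c i \<in> R" "\<And>i. f (V i) = (\<lambda>n. n + c i) ` M" by metis
  have "i = j" if d: "c i - c j \<in> M" for i j
  proof -
    have sub: "(\<lambda>n. n + a) ` M \<subseteq> (\<lambda>n. n + b) ` M" if "a - b \<in> M" for a b
    proof
      fix y assume "y \<in> (\<lambda>n. n + a) ` M"
      then obtain n where "n \<in> M" "y = n + a" by blast
      then show "y \<in> (\<lambda>n. n + b) ` M" using M_add[OF _ that, of n]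
        by (intro image_eqI[of _ _ "n + (a - b)"]) auto
    qed
    have "f (V i) = f (V j)"
      using sub[OF d] sub[of "c j" "c i"] M_uminus[OF d] c(2) by auto
    then show ?thesis using f(1) V V_inj by (auto simp: inj_on_def)
  qed
  then show ?thesis using c(1) by blast
qed

section \<open>Value sets are good\<close>

text \<open>If \<open>x\<close> and \<open>y\<close> have the same \<open>j\<close>-th value, then \<open>x / y\<close> has a nonzero residue in \<open>V\<^sub>j\<close>, and by
residual rationality this is the residue of a unit \<open>u\<close> of \<open>R\<close>. Then \<open>x - u y\<close> has a larger
\<open>j\<close>-th value, and since all values of \<open>u\<close> vanish, the other values behave as for \<open>x - y\<close>.\<close>
lemma value_set_exchange:
  assumes add: "\<And>x y. x \<in> J \<Longrightarrow> y \<in> J \<Longrightarrow> x + y \<in> J"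
    and smult: "\<And>a x. a \<in> R \<Longrightarrow> x \<in> J \<Longrightarrow> a * x \<in> J"
    and x: "x \<in> J" "x \<in> Q_reg" and y: "y \<in> J" "y \<in> Q_reg" and eq: "v j x = v j y"
  shows "\<exists>z \<in> J. z \<in> Q_reg \<and> v j x < v j z \<and> (\<forall>k. min (v k x) (v k y) \<le> v k z) \<and>
    (\<forall>k. v k x \<noteq> v k y \<longrightarrow> v k z = min (v k x) (v k y))"
proof -
  obtain N where N: "ideal N (ring_on (V j))" "N \<inter> R = M"
      "\<And>x. x \<in> Q_reg \<Longrightarrow> x \<in> N \<longleftrightarrow> 0 < v j x" "\<And>y. y \<in> V j \<Longrightarrow> \<exists>u \<in> R. y - u \<in> N"
    using residue_ideal[of j] by blast
  have N_add: "\<And>x y. x \<in> N \<Longrightarrow> y \<in> N \<Longrightarrow> x + y \<in> N"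
    using N(1) unfolding ideal_ring_on_iff[OF V_subring] by blast
  obtain y' where y': "y' \<in> Q_reg" "y * y' = 1" using Q_reg_inverse[OF y(2)] by blast
  define q where "q = x * y'"
  have q: "q \<in> Q_reg" "x = q * y"
    using x y' by (auto simp: q_def mult.assoc mult.commute[of y' y])
  have vq: "v j q = 0" using v_mult[OF q(1) y(2), of j] q eq by simp
  then have "q \<in> V j" using V_iff q by simp
  then obtain u where u: "u \<in> R" "q - u \<in> N" using N(4) by blast
  obtain w where w: "w \<in> R" "w \<in> Q_reg" "w - (- u) \<in> M" "x + w * y \<in> Q_reg"
    using regular_perturbation[OF y(2) R_uminus[OF u(1)]] by blast
  define z where "z = x + w * y"
  have "q + w = (q - u) + (w - (- u))" by simp
  also have "\<dots> \<in> N" using u w(3) N(2) N_add by blast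
  finally have qw: "q + w \<in> N" .
  have z: "z = (q + w) * y" by (simp add: z_def q(2) distrib_right)
  have qw_reg: "q + w \<in> Q_reg" using w(4) z by (simp add: z_def)
  have "w \<notin> M"
  proof
    assume "w \<in> M"
    then have "- w \<in> N" using M_uminus N(2) by blast
    then have "q \<in> N" using N_add[OF qw] by force
    then show False using N(3) q vq by simp
  qed
  then have v_wy: "v k (w * y) = v k y" for k
    using v_mult[OF w(2) y(2), of k] v_outside_M[OF w(1)] by simp
  have wy: "w * y \<in> Q_reg" using w y by simp
  have "z \<in> J" unfolding z_def using x y w add smult by blast
  moreover have "v j x < v j z"
    using v_mult[OF qw_reg y(2), of j] qw qw_reg N(3) eq z by simp
  moreover have "min (v k x) (v k y) \<le> v k z" for k
    using v_add[OF x(2) wy w(4), of k] v_wy by (simp add: z_def)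
  moreover have "v k z = min (v k x) (v k y)" if "v k x \<noteq> v k y" for k
    using v_add_eq[OF x(2) wy w(4), of k] v_wy that by (simp add: z_def)
  ultimately show ?thesis using w(4) by (auto simp: z_def)
qed

text \<open>The candidates for \<open>z\<close> are \<open>y\<close> and \<open>x + w\<^sub>i y\<close> for \<open>r\<close> elements \<open>w\<^sub>i\<close> of \<open>R\<close> with distinct residues:
\<open>r + 1\<close> points of the projective line over the residue field. Any two of them generate
the same \<open>R\<close>-module as \<open>x\<close> and \<open>y\<close>, so for each valuation at most one candidate can have a
value above the minimum. As there are only \<open>r\<close> valuations, some candidate attains the
minimum for all of them.\<close>
lemma value_set_min:
  assumes add: "\<And>x y. x \<in> J \<Longrightarrow> y \<in> J \<Longrightarrow> x + y \<in> J"
    and smult: "\<And>a x. a \<in> R \<Longrightarrow> x \<in> J \<Longrightarrow> a * x \<in> J"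
    and x: "x \<in> J" "x \<in> Q_reg" and y: "y \<in> J" "y \<in> Q_reg"
  shows "\<exists>z \<in> J. z \<in> Q_reg \<and> (\<forall>k. v k z = min (v k x) (v k y))"
proof (rule ccontr)
  assume neg: "\<not> ?thesis"
  obtain c :: "'r \<Rightarrow> 'a" where c: "\<And>i. c i \<in> R" "\<And>i j. i \<noteq> j \<Longrightarrow> c i - c j \<notin> M"
    using residue_representatives by blast
  have "\<exists>w \<in> R. w \<in> Q_reg \<and> w - c i \<in> M \<and> x + w * y \<in> Q_reg" for i
    by (rule regular_perturbation[OF y(2) c(1)])
  then obtain w where w: "\<And>i. w i \<in> R" "\<And>i. w i \<in> Q_reg" "\<And>i. w i - c i \<in> M"
      "\<And>i. x + w i * y \<in> Q_reg" by metis
  have w_diff: "w i - w j \<notin> M" if "i \<noteq> j" for i j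
  proof
    assume "w i - w j \<in> M"
    then have "(w i - w j) - ((w i - c i) - (w j - c j)) \<in> M" using w(3) by (intro M_diff[of "w i - w j"] M_diff[of "w i - c i"])
    then show False using c(2)[OF that] by (simp add: algebra_simps)
  qed
  define \<mu> where "\<mu> k = min (v k x) (v k y)" for k
  define Z where "Z p = (case p of None \<Rightarrow> y | Some i \<Rightarrow> x + w i * y)" for p
  have Z: "Z p \<in> J" "Z p \<in> Q_reg" for p
    using x y w add smult by (auto simp: Z_def split: option.split)
  have Z_ge: "\<mu> k \<le> v k (Z p)" for p k
  proof (cases p)
    case (Some i)
    have "w i * y \<in> Q_reg" using w y by simp
    from v_add[OF x(2) this w(4), of k] show ?thesis
      using v_mult[OF w(2) y(2), of k i] v_nonneg[OF w(1,2), of k i] Some by (simp add: Z_def \<mu>_def)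
  qed (simp add: Z_def \<mu>_def)
  have "\<exists>k. \<mu> k < v k (Z p)" for p
    using neg Z[of p] Z_ge[of _ p] unfolding \<mu>_def by (metis order_le_less)
  then obtain bad where bad: "\<And>p. \<mu> (bad p) < v (bad p) (Z p)" by metis
  have no_common_excess: False if "\<mu> k < v k y" "\<mu> k < v k (Z (Some i))" for k i
  proof -
    have wy: "w i * y \<in> Q_reg" using w y by simp
    have "v k y \<le> v k (w i * y)"
      using v_mult[OF w(2) y(2), of k i] v_nonneg[OF w(1,2), of k i] by simp
    moreover have "min (v k (x + w i * y)) (v k (w i * y)) \<le> v k (x + w i * y - w i * y)"
      using x wy w(4) by (intro v_diff) auto
    ultimately show False using that by (simp add: Z_def \<mu>_def)
  qed
  have "inj bad"
  proof (rule injI, rule ccontr)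
    fix p q assume pq: "bad p = bad q" "p \<noteq> q"
    define k where "k = bad p"
    have k: "\<mu> k < v k (Z p)" "\<mu> k < v k (Z q)" using bad[of p] bad[of q] pq(1) by (auto simp: k_def)
    show False
    proof (cases "p = None \<or> q = None")
      case True
      then obtain i where "{p, q} = {None, Some i}" using pq(2) by (cases p; cases q) auto
      then have "\<mu> k < v k (Z None)" "\<mu> k < v k (Z (Some i))" using k by (auto simp: doubleton_eq_iff)
      then show False using no_common_excess[of k i] by (simp add: Z_def)
    next
      case False
      then obtain i j where ij: "p = Some i" "q = Some j" by auto
      have d: "w i - w j \<notin> M" using w_diff ij pq(2) by blast
      have d_R: "w i - w j \<in> R" using R_add[OF w(1) R_uminus[OF w(1)], of i j] by simp
      have d_reg: "w i - w j \<in> Q_reg" using regular_outside_M d d_R by blast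
      have diff: "Z p - Z q = (w i - w j) * y" by (simp add: Z_def ij algebra_simps)
      have "min (v k (Z p)) (v k (Z q)) \<le> v k (Z p - Z q)"
        using Z d_reg y by (intro v_diff) (auto simp: diff)
      also have "\<dots> = v k y"
        unfolding diff using v_mult[OF d_reg y(2), of k] v_outside_M[OF d_R d] by simp
      finally have "\<mu> k < v k y" using k by simp
      then show False using no_common_excess[of k i] k(1) ij by simp
    qed
  qed
  then have "card (UNIV :: 'r option set) \<le> card (UNIV :: 'r set)"
    by (intro card_inj_on_le[of bad]) auto
  then show False by (simp add: card_UNIV_option)
qed

lemma good_value_set:
  assumes "\<And>x y. x \<in> J \<Longrightarrow> y \<in> J \<Longrightarrow> x + y \<in> J"
    and "\<And>a x. a \<in> R \<Longrightarrow> x \<in> J \<Longrightarrow> a * x \<in> J"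
  shows "good_set (value_set v J)"
proof
  fix a b assume "a \<in> value_set v J" "b \<in> value_set v J"
  then obtain x y where x: "x \<in> J" "x \<in> Q_reg" "a = (\<chi> i. v i x)"
    and y: "y \<in> J" "y \<in> Q_reg" "b = (\<chi> i. v i y)" by (auto simp: value_set_def)
  obtain z where "z \<in> J" "z \<in> Q_reg" "\<And>k. v k z = min (v k x) (v k y)"
    using value_set_min[OF assms x(1,2) y(1,2)] by blast
  then show "(\<chi> k. min (a $ k) (b $ k)) \<in> value_set v J"
    unfolding value_set_def by (intro image_eqI[of _ _ z]) (auto simp: x y)
  fix j assume "a $ j = b $ j"
  then have "v j x = v j y" by (simp add: x y)
  from value_set_exchange[OF assms x(1,2) y(1,2) this]
  obtain z where "z \<in> J" "z \<in> Q_reg" "v j x < v j z" "\<forall>k. min (v k x) (v k y) \<le> v k z"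
      "\<forall>k. v k x \<noteq> v k y \<longrightarrow> v k z = min (v k x) (v k y)" by blast
  then show "\<exists>g \<in> value_set v J. a $ j < g $ j \<and> (\<forall>k. min (a $ k) (b $ k) \<le> g $ k) \<and>
      (\<forall>k. a $ k \<noteq> b $ k \<longrightarrow> g $ k = min (a $ k) (b $ k))"
    unfolding value_set_def by (intro bexI[of _ "\<chi> i. v i z"]) (auto simp: x y)
qed

text \<open>\<open>consecutive\<close> holds because the valuations are onto \<open>\<int>\<close> and every element of \<open>Q\<close> is a
fraction. Were two coordinates proportional on \<open>R\<close>, they would be so on all regular elements
of \<open>Q\<close>, with a positive factor, and the two valuation rings would have the same regular
elements.\<close>
lemma good_value_semigroup: "good_semigroup (value_set v R)"
proof -
  interpret good_set "value_set v R" using R_add R_mult by (rule good_value_set)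
  have mem: "(\<chi> i. v i x) \<in> value_set v R" if "x \<in> R" "x \<in> Q_reg" for x
    using that by (auto simp: value_set_def)
  show ?thesis
  proof
    show "a + b \<in> value_set v R" if ab: "a \<in> value_set v R" "b \<in> value_set v R" for a b
    proof -
      obtain x y where x: "x \<in> R" "x \<in> Q_reg" "a = (\<chi> i. v i x)"
        and y: "y \<in> R" "y \<in> Q_reg" "b = (\<chi> i. v i y)" using ab by (auto simp: value_set_def)
      have "a + b = (\<chi> i. v i (x * y))" using x y v_mult by (simp add: vec_eq_iff)
      then show ?thesis using mem[of "x * y"] R_mult x y by simp
    qed
    have "(\<chi> i. v i 1) = 0" by (simp add: vec_eq_iff)
    then show "0 \<in> value_set v R" using mem[OF R_one Q_reg_one] by simp
    show "0 \<le> a $ k" if "a \<in> value_set v R" for a k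
      using that v_nonneg by (auto simp: value_set_def)
    obtain m where "m \<in> M" "m \<in> Q_reg" using regular_in_M by blast
    then show "\<exists>m \<in> value_set v R. \<forall>k. 0 < m $ k"
      using mem[of m] M_R in_M_iff by (intro bexI[of _ "\<chi> i. v i m"]) auto
    show "\<exists>s \<in> value_set v R. \<exists>t \<in> value_set v R. s $ j = t $ j + 1" for j
    proof -
      obtain t where t: "t \<in> Q_reg" "v j t = 1" using v_surj by blast
      obtain a s where as: "a \<in> R" "s \<in> R" "s \<in> Q_reg" "s * t = a" using Q_reg_fraction by blast
      have "a \<in> Q_reg" "v j a = v j s + 1" using as t v_mult[of s t j] by auto
      then show ?thesis using mem[of a] mem[of s] as
        by (intro bexI[of _ "\<chi> i. v i a"] bexI[of _ "\<chi> i. v i s"]) auto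
    qed
    show "\<exists>s \<in> value_set v R. \<exists>t \<in> value_set v R. s $ i * t $ j \<noteq> s $ j * t $ i"
      if ij: "i \<noteq> j" for i j
    proof (rule ccontr)
      assume neg: "\<not> ?thesis"
      obtain m where m: "m \<in> M" "m \<in> Q_reg" using regular_in_M by blast
      have pos: "0 < v i m" "0 < v j m" using m in_M_iff M_R by auto
      have proportional: "v i x * v j m = v j x * v i m" if "x \<in> R" "x \<in> Q_reg" for x
        using neg mem[OF that] mem[OF M_R[OF m(1)] m(2)] by force
      obtain x where x: "x \<in> Q_reg" "(0 \<le> v i x) \<noteq> (0 \<le> v j x)" using V_separated[OF ij] by blast
      obtain a s where as: "a \<in> R" "s \<in> R" "s \<in> Q_reg" "s * x = a" using Q_reg_fraction by blast
      have "v k a = v k s + v k x" for k using v_mult[OF as(3) x(1)] as(4) by simp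
      moreover have "a \<in> Q_reg" using as x by auto
      ultimately have "v i x * v j m = v j x * v i m"
        using proportional[OF as(2,3)] proportional[OF as(1)] by (simp add: distrib_right)
      then have "0 \<le> v i x * v j m \<longleftrightarrow> 0 \<le> v j x * v i m" by simp
      then show False using x(2) pos by (simp add: zero_le_mult_iff)
    qed
  qed
qed

text \<open>A common denominator of \<open>J\<close> bounds the values of \<open>J\<close> from below, and a translate of the value
semigroup of \<open>R\<close> by the value of a regular element of \<open>J\<close> supplies the orthant.\<close>
lemma no_fiber_at_frobenius:
  assumes "regular_fractional_ideal R J"
  shows "fiber_union (value_set v J) (frobenius_vector v J) = {}"
proof -
  have add: "\<And>x y. x \<in> J \<Longrightarrow> y \<in> J \<Longrightarrow> x + y \<in> J"
    and smult: "\<And>a x. a \<in> R \<Longrightarrow> x \<in> J \<Longrightarrow> a * x \<in> J"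
    using assms by (auto simp: regular_fractional_ideal_def fractional_ideal_def)
  obtain d where d: "d \<in> regular_elements (ring_on R)" "\<And>x. x \<in> J \<Longrightarrow> d * x \<in> R"
    using assms unfolding regular_fractional_ideal_def fractional_ideal_def by blast
  have d_reg: "d \<in> Q_reg" using regular_R_unit[OF d(1)] Q_reg_iff by blast
  obtain h where h: "h \<in> J" "h \<in> Q_reg"
    using assms unfolding regular_fractional_ideal_def by blast
  interpret good_set "value_set v J" by (rule good_value_set[OF add smult])
  obtain \<gamma> where \<gamma>: "\<forall>\<beta>\<ge>\<gamma>. \<beta> \<in> value_set v R"
    using good_semigroup.contains_orthant[OF good_value_semigroup] by blast
  have below: "\<forall>\<beta> \<in> value_set v J. - (\<chi> i. v i d) \<le> \<beta>"
  proof
    fix \<beta> assume "\<beta> \<in> value_set v J"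
    then obtain x where x: "x \<in> J" "x \<in> Q_reg" "\<beta> = (\<chi> i. v i x)" by (auto simp: value_set_def)
    have "- v i d \<le> v i x" for i
      using v_nonneg[OF d(2)[OF x(1)], of i] v_mult[OF d_reg x(2), of i] d_reg x(2) by auto
    then show "- (\<chi> i. v i d) \<le> \<beta>" by (simp add: less_eq_vec_def x)
  qed
  have "\<forall>\<beta>\<ge>\<gamma> + (\<chi> i. v i h). \<beta> \<in> value_set v J"
  proof (intro allI impI)
    fix \<beta> assume "\<gamma> + (\<chi> i. v i h) \<le> \<beta>"
    then have "\<gamma> \<le> \<beta> - (\<chi> i. v i h)" by (simp add: less_eq_vec_def le_diff_eq)
    then have "\<beta> - (\<chi> i. v i h) \<in> value_set v R" using \<gamma> by blast
    then obtain x where x: "x \<in> R" "x \<in> Q_reg" "\<beta> - (\<chi> i. v i h) = (\<chi> i. v i x)"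
      by (auto simp: value_set_def)
    have "\<beta> = (\<chi> i. v i (x * h))"
      using x(3) v_mult[OF x(2) h(2)] by (simp add: vec_eq_iff diff_eq_eq)
    then show "\<beta> \<in> value_set v J" unfolding value_set_def using smult x h by auto
  qed
  from no_fiber_below_conductor[OF below this] show ?thesis
    by (simp add: frobenius_vector_def)
qed

text \<open>Multiplying by an element of value \<open>a\<close> translates a fiber at \<open>f - a\<close> into a fiber of \<open>J\<close> at its
Frobenius vector \<open>f\<close>, which is empty.\<close>
lemma no_fiber_at_complement:
  assumes J: "regular_fractional_ideal R J"
    and AB: "\<And>x y. x \<in> A \<Longrightarrow> y \<in> B \<Longrightarrow> x * y \<in> J"
    and a: "a \<in> value_set v A"
  shows "fiber_union (value_set v B) (frobenius_vector v J - a) = {}"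
proof (rule ccontr)
  let ?f = "frobenius_vector v J"
  assume "fiber_union (value_set v B) (?f - a) \<noteq> {}"
  then obtain i b where b: "b \<in> fiber {i} (value_set v B) (?f - a)"
    by (auto simp: fiber_union_def)
  obtain x where x: "x \<in> A" "x \<in> Q_reg" "a = (\<chi> i. v i x)" using a by (auto simp: value_set_def)
  obtain y where y: "y \<in> B" "y \<in> Q_reg" "b = (\<chi> i. v i y)"
    using b by (auto simp: fiber_def value_set_def)
  have "(\<chi> k. v k (x * y)) = a + b" using v_mult[OF x(2) y(2)] by (simp add: x y vec_eq_iff)
  then have "a + b \<in> value_set v J" unfolding value_set_def using AB x y by force
  then have "a + b \<in> fiber {i} (value_set v J) ?f" using b by (auto simp: fiber_def algebra_simps)
  then show False using no_fiber_at_frobenius[OF J] by (auto simp: fiber_union_def)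
qed

end

section \<open>Maximal points\<close>

lemma p_number_ge_1:
  fixes E :: "(int ^ 'r::finite) set"
  assumes "fiber_union E \<alpha> = {}"
  shows "1 \<le> p_number E \<alpha>"
  unfolding p_number_def
proof (rule Max_ge)
  have "fiber K E \<alpha> = {}" if "K \<noteq> {}" "card K \<le> 1" for K :: "'r set"
  proof -
    have "card K = 1" using that by (simp add: le_Suc_eq)
    then obtain i where "K = {i}" by (rule card_1_singletonE)
    then show ?thesis using assms by (auto simp: fiber_union_def)
  qed
  then show "1 \<in> {n \<in> {0..CARD('r)}. \<forall>K. K \<noteq> {} \<and> card K \<le> n \<longrightarrow> fiber K E \<alpha> = {}}"
    by (simp add: Suc_le_eq)
qed simp

lemma q_number_le_card:
  fixes E :: "(int ^ 'r::finite) set"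
  assumes "\<alpha> \<in> E"
  shows "q_number E \<alpha> \<le> CARD('r)"
  unfolding q_number_def
proof (rule Min_le)
  have "fiber K E \<alpha> \<noteq> {}" if "CARD('r) \<le> card K" for K :: "'r set"
  proof -
    have "K = UNIV" using that by (intro card_seteq) auto
    then show ?thesis using assms by (auto simp: fiber_def)
  qed
  then show "CARD('r) \<in> {n \<in> {1..CARD('r) + 1}. \<forall>K. K \<noteq> {} \<and> n \<le> card K \<longrightarrow> fiber K E \<alpha> \<noteq> {}}"
    by (simp add: Suc_le_eq)
qed simp

theorem theorem9:
  fixes R M I J :: "'a::comm_ring_1 set"
    and V :: "'r::finite \<Rightarrow> 'a set"
    and v :: "'r \<Rightarrow> 'a \<Rightarrow> int"
    and \<alpha> :: "int ^ 'r"
  assumes "admissible_ring R M"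
    and "bij_betw V UNIV (valuation_rings R)"
    and "\<And>i. discrete_valuation_of (V i) (v i)"
    and "regular_fractional_ideal R I"
    and "regular_fractional_ideal R J"
    and "\<alpha> \<in> value_set v I"
    and "frobenius_vector v J - \<alpha> \<in> value_set v (colon J I)"
  shows "(maximal_point (value_set v I) \<alpha> \<longleftrightarrow>
           maximal_point (value_set v (colon J I)) (frobenius_vector v J - \<alpha>)) \<and>
         (\<forall>p q. maximal_point_of_type (value_set v I) \<alpha> p q \<longrightarrow>
           (\<exists>p' q'.
              maximal_point_of_type (value_set v (colon J I)) (frobenius_vector v J - \<alpha>) p' q' \<and>
              int p' = rho v J (colon J I) (frobenius_vector v J - \<alpha>) + 1
                       - int (q_number (value_set v (colon J (colon J I))) \<alpha>) \<and>
              int q' = rho v J I \<alpha> + 1 - int p))"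
proof -
  interpret admissible_valuations R M V v
    using assms(1,2,3) by unfold_locales
  let ?\<beta> = "frobenius_vector v J - \<alpha>"
  have colon: "x * y \<in> J" "y * x \<in> J" if "x \<in> I" "y \<in> colon J I" for x y
    using that by (auto simp: colon_def mult.commute)
  have "fiber_union (value_set v (colon J I)) ?\<beta> = {}"
    using no_fiber_at_complement[OF assms(5) colon(1) assms(6)] .
  then have max_\<beta>: "maximal_point (value_set v (colon J I)) ?\<beta>"
    using assms(7) by (simp add: maximal_point_def)
  have "fiber_union (value_set v I) (frobenius_vector v J - ?\<beta>) = {}"
    using no_fiber_at_complement[OF assms(5) colon(2) assms(7)] .
  then have max_\<alpha>: "maximal_point (value_set v I) \<alpha>"
    using assms(6) by (simp add: maximal_point_def)
  have "maximal_point_of_type (value_set v (colon J I)) ?\<beta>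
      (p_number (value_set v (colon J I)) ?\<beta>) (q_number (value_set v (colon J I)) ?\<beta>)"
    using max_\<beta> p_number_ge_1 q_number_le_card
    by (auto simp: maximal_point_of_type_def maximal_point_def)
  moreover have "int (p_number (value_set v (colon J I)) ?\<beta>) = rho v J (colon J I) ?\<beta> + 1
      - int (q_number (value_set v (colon J (colon J I))) \<alpha>)"
    by (simp add: rho_def)
  moreover have "int (q_number (value_set v (colon J I)) ?\<beta>) = rho v J I \<alpha> + 1 - int p"
    if "maximal_point_of_type (value_set v I) \<alpha> p q" for p q
    using that by (simp add: rho_def maximal_point_of_type_def)
  ultimately show ?thesis using max_\<alpha> max_\<beta> by blast
qed

end
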